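(* Let $K$ be a totally real number field of degree $d$ over $\mathbb{Q}$ with ring of integers $\mathcal{O}_K$ and discriminant $\Delta_K$. Let $n>d$ be an integer and let $\boldsymbol\alpha=(\alpha_1,\dots,\alpha_n)$ be an $n$-tuple of nonzero elements of $\mathcal{O}_K^+$ such that $\mathcal{O}_K=\operatorname{span}_{\mathbb{Z}}\{\alpha_1,\dots,\alpha_n\}$. Let $\beta\in\operatorname{Sg}(\boldsymbol\alpha)$. Then there exists $\boldsymbol x\in\mathbb{Z}_{\ge0}^n$ such that $\sum_{i=1}^n\alpha_ix_i=\beta$, and for any such $\boldsymbol x$ we have $$\frac1n\left(\frac{H_K(\beta)}{H_K(\boldsymbol\alpha)}\right)^{1/d}\le|\boldsymbol x|\le\mathcal{M}(\boldsymbol\alpha,\beta).$$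
   Context: Let $\sigma_1,\dots,\sigma_d:K\to\mathbb{R}$ be the embeddings of $K$. Put $\mathcal{O}_K^+=\{\alpha\in\mathcal{O}_K:\sigma_i(\alpha)\ge 0 \text{ for all } 1\le i\le d\}$ and $\operatorname{Sg}(\boldsymbol\alpha)=\{\sum_{i=1}^n\alpha_ix_i:\boldsymbol x\in\mathbb{Z}_{\ge 0}^n\}$. For $\boldsymbol x\in\mathbb{Z}^n$, $|\boldsymbol x|=\max\{|x_i|:1\le i\le n\}$. Let $\boldsymbol\alpha(\beta)=(\alpha_1,\dots,\alpha_n,\beta)\in K^{n+1}$ and $\mathcal{J}(n+1,d)=\{I\subset\{1,\dots,n+1\}:|I|=d\}$. For $I\in\mathcal{J}(n+1,d)$, $\operatorname{disc}(\boldsymbol\alpha(\beta)_I)$ is the discriminant of the $d$ coordinates of $\boldsymbol\alpha(\beta)$ indexed by $I$, i.e. for elements $\gamma_1,\dots,\gamma_d$ of $K$ the discriminant is $\det(\sigma_j(\gamma_k))_{1\le j,k\le d}^2$. Define $$\mathcal{M}(\boldsymbol\alpha,\beta)=\frac{1}{|\Delta_K|^{1/2}}\max_{I\in\mathcal{J}(n+1,d)}|\operatorname{disc}(\boldsymbol\alpha(\beta)_I)|^{1/2}.$$ Let $M(K)$ be the set of places of $K$ and $d_v=[K_v:\mathbb{Q}_v]$ the local degree at $v$. Absolute values are normalized so that the product formula reads $\prod_{v\in M(K)}|a|_v=1$ for all nonzero $a\in K$, i.e. $|\cdot|_v$ is the $d_v$-th power of the absolute value extending the usual (real or $p$-adic)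 one on $\mathbb{Q}$. For $\boldsymbol\gamma=(\gamma_1,\dots,\gamma_m)\in K^m$ (in particular for a single element, $m=1$) the inhomogeneous height is $$H_K(\boldsymbol\gamma)=\prod_{v\in M(K)}\max\{1,|\gamma_1|_v,\dots,|\gamma_m|_v\}.$$
   Formalization: The lower bound is stated only for β ≠ 0, because for β = 0 the only representation is x = 0 and the left-hand side is positive, so the printed bound fails; existence and the upper bound are stated for every β in Sg(α). *)

theory Defs
  imports
    "HOL-Algebra.Embedded_Algebras"
    "HOL-Algebra.QuotRing"
    "HOL-Analysis.Analysis"
    "Jordan_Normal_Form.Determinant"
begin

text \<open>
  Tuples are lists, with components numbered from 0. Ring homomorphisms between fields are
  given by the locale predicate \<^const>\<open>field_hom\<close>.
\<close>

section \<open>Number fields\<close>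

class number_field = field_char_0 +
  assumes finite_dim_over_rat:
    "\<exists>B. finite B \<and> (\<forall>x. \<exists>c :: 'a \<Rightarrow> rat. x = (\<Sum>b\<in>B. of_rat (c b) * b))"

definition field_degree :: "'k::number_field itself \<Rightarrow> nat" where
  "field_degree _ = vector_space.dim (\<lambda>(q::rat) (x::'k). of_rat q * x) UNIV"

definition totally_real :: "'k::number_field itself \<Rightarrow> bool" where
  "totally_real _ \<longleftrightarrow> (\<forall>\<tau> :: 'k \<Rightarrow> complex. field_hom \<tau> \<longrightarrow> range \<tau> \<subseteq> \<real>)"

definition ring_of_integers :: "'k::number_field set" where
  "ring_of_integers = {a. algebraic_int a}"

definition nonneg_integers :: "'k::number_field set" where
  "nonneg_integers = {a \<in> ring_of_integers. \<forall>\<sigma> :: 'k \<Rightarrow> real. field_hom \<sigma> \<longrightarrow> 0 \<le> \<sigma> a}"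

section \<open>Integer combinations\<close>

definition int_comb :: "'k::number_field list \<Rightarrow> int list \<Rightarrow> 'k" where
  "int_comb \<alpha> x = (\<Sum>i<length \<alpha>. \<alpha> ! i * of_int (x ! i))"

definition nonneg_tuples :: "nat \<Rightarrow> int list set" where
  "nonneg_tuples n = {x. length x = n \<and> (\<forall>i<n. 0 \<le> x ! i)}"

definition int_span :: "'k::number_field list \<Rightarrow> 'k set" where
  "int_span \<alpha> = int_comb \<alpha> ` {x. length x = length \<alpha>}"

definition Sg :: "'k::number_field list \<Rightarrow> 'k set" where
  "Sg \<alpha> = int_comb \<alpha> ` nonneg_tuples (length \<alpha>)"

definition sup_norm :: "int list \<Rightarrow> int" where
  "sup_norm x = Max (abs ` set x)"

section \<open>Discriminants\<close>

text \<open>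
  Here \<open>\<sigma>\<close> lists the real embeddings of a totally real field, so that its length is the
  degree. No discriminant depends on the order of this list.
\<close>

definition disc :: "('k::number_field \<Rightarrow> real) list \<Rightarrow> 'k list \<Rightarrow> real" where
  "disc \<sigma> \<gamma> = (Determinant.det (mat (length \<sigma>) (length \<sigma>) (\<lambda>(j, k). (\<sigma> ! j) (\<gamma> ! k))))\<^sup>2"

definition integral_basis :: "'k::number_field list \<Rightarrow> bool" where
  "integral_basis \<omega> \<longleftrightarrow> bij_betw (int_comb \<omega>) {c. length c = length \<omega>} ring_of_integers"

definition field_disc :: "('k::number_field \<Rightarrow> real) list \<Rightarrow> real" where
  "field_disc \<sigma> = (THE D. \<exists>\<omega>. length \<omega> = length \<sigma> \<and> integral_basis \<omega> \<and> D = disc \<sigma> \<omega>)"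

text \<open>
  The list \<open>nths (\<alpha> @ [\<beta>]) I\<close> consists of the coordinates of \<open>\<alpha>(\<beta>)\<close> with index in \<open>I\<close>.
\<close>

definition max_minor ::
    "('k::number_field \<Rightarrow> real) list \<Rightarrow> 'k list \<Rightarrow> 'k \<Rightarrow> real" where
  "max_minor \<sigma> \<alpha> \<beta> =
     1 / sqrt \<bar>field_disc \<sigma>\<bar> *
     Max ((\<lambda>I. sqrt \<bar>disc \<sigma> (nths (\<alpha> @ [\<beta>]) I)\<bar>) `
          {I. I \<subseteq> {..<length \<alpha> + 1} \<and> card I = length \<sigma>})"

section \<open>Places and heights\<close>

definition absolute_value :: "('k::number_field \<Rightarrow> real) \<Rightarrow> bool" where
  "absolute_value v \<longleftrightarrow>
     (\<forall>x. 0 \<le> v x) \<and> (\<forall>x. v x = 0 \<longleftrightarrow> x = 0) \<and>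
     (\<forall>x y. v (x * y) = v x * v y) \<and> (\<forall>x y. v (x + y) \<le> v x + v y)"

definition padic_abs :: "nat \<Rightarrow> rat \<Rightarrow> real" where
  "padic_abs p q =
     (if q = 0 then 0
      else real p powi (int (multiplicity (int p) (snd (quotient_of q))) -
                        int (multiplicity (int p) (fst (quotient_of q)))))"

text \<open>
  A place, i.e. an equivalence class of nontrivial absolute values, is represented by its
  unique member that extends the usual real or a \<open>p\<close>-adic absolute value on the rationals.
\<close>

definition places :: "('k::number_field \<Rightarrow> real) set" where
  "places = {v. absolute_value v \<and>
     ((\<forall>q. v (of_rat q) = \<bar>of_rat q\<bar>) \<or>
      (\<exists>p::nat. Factorial_Ring.prime p \<and> (\<forall>q. v (of_rat q) = padic_abs p q)))}"

text \<open>
  The completion at \<open>v\<close> is the ring of Cauchy sequences modulo the ideal of null sequences;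
  in it the rational Cauchy sequences represent the completion of the rationals.
\<close>

definition cauchy_seqs :: "('k::number_field \<Rightarrow> real) \<Rightarrow> (nat \<Rightarrow> 'k) set" where
  "cauchy_seqs v = {f. \<forall>e>0. \<exists>N. \<forall>m\<ge>N. \<forall>n\<ge>N. v (f m - f n) < e}"

definition null_seqs :: "('k::number_field \<Rightarrow> real) \<Rightarrow> (nat \<Rightarrow> 'k) set" where
  "null_seqs v = {f. (\<lambda>m. v (f m)) \<longlonglongrightarrow> 0}"

definition cauchy_ring :: "('k::number_field \<Rightarrow> real) \<Rightarrow> (nat \<Rightarrow> 'k) ring" where
  "cauchy_ring v =
     \<lparr>carrier = cauchy_seqs v, monoid.mult = (\<lambda>f g m. f m * g m), one = (\<lambda>_. 1),
      zero = (\<lambda>_. 0), add = (\<lambda>f g m. f m + g m)\<rparr>"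

definition completion :: "('k::number_field \<Rightarrow> real) \<Rightarrow> (nat \<Rightarrow> 'k) set ring" where
  "completion v = cauchy_ring v Quot null_seqs v"

definition rat_completion :: "('k::number_field \<Rightarrow> real) \<Rightarrow> (nat \<Rightarrow> 'k) set set" where
  "rat_completion v =
     (\<lambda>f. null_seqs v +>\<^bsub>cauchy_ring v\<^esub> f) ` {f \<in> cauchy_seqs v. range f \<subseteq> \<rat>}"

definition local_degree :: "('k::number_field \<Rightarrow> real) \<Rightarrow> nat" where
  "local_degree v = ring.dim (completion v) (rat_completion v) (carrier (completion v))"

definition place_abs :: "('k::number_field \<Rightarrow> real) \<Rightarrow> 'k \<Rightarrow> real" where
  "place_abs v a = v a ^ local_degree v"

definition local_height :: "'k::number_field list \<Rightarrow> ('k \<Rightarrow> real) \<Rightarrow> real" where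
  "local_height \<gamma> v = Max (insert 1 (place_abs v ` set \<gamma>))"

text \<open>All but finitely many local factors are 1, and the product is over the others.\<close>

definition height :: "'k::number_field list \<Rightarrow> real" where
  "height \<gamma> = (\<Prod>v\<in>{v \<in> places. local_height \<gamma> v \<noteq> 1}. local_height \<gamma> v)"

end

theory Submission
  imports Defs "Jordan_Normal_Form.Char_Poly"
begin

text \<open>
  For the upper bound, consider the rational points of the polytope of all nonnegative
  representations of \<open>\<beta>\<close>. It is bounded because the entries of \<open>\<alpha>\<close> are positive at every embedding,
  and a coordinate is largest at a vertex, where the entries of \<open>\<alpha>\<close> that occur are linearly
  independent. In place of linear programming, lemma \<open>conic_caratheodory\<close> moves from a given
  representation to an independent one without lowering the chosen coordinate. After extension to
  a basis of the field by entries of \<open>\<alpha>\<close>, Cramer's rule writes the coordinate as a quotient of two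
  determinants of embeddings. The numerator is a minor of \<open>\<alpha> @ [\<beta>]\<close>. The denominator is the
  determinant of a tuple of integers, which is at least the square root of the discriminant of the
  field (\<open>field_disc_minimal\<close>). That there is an integral basis at all follows by choosing an
  integral tuple of least nonzero determinant.
  
  For the lower bound, both heights are products over the archimedean places only, since integers
  have absolute value at most 1 elsewhere. Lemma \<open>archimedean_absolute_value_is_embedding\<close>
  identifies these places with embeddings of the field into the reals, and \<open>local_degree_real\<close> shows
  that their local degrees are 1. At each of these at most \<open>d\<close> places the triangle inequality gives
  \<open>v \<beta> \<le> n * sup_norm x * Max (v ` set \<alpha>)\<close>. Multiplying over the places bounds the height of \<open>\<beta>\<close> by
  \<open>(n * sup_norm x) ^ d\<close> times the height of \<open>\<alpha>\<close>.
\<close>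

section \<open>Rational linear algebra in a number field\<close>

interpretation Q: vector_space "\<lambda>(q::rat) (x::'k::number_field). of_rat q * x"
  by unfold_locales (simp_all add: algebra_simps of_rat_add of_rat_mult)

definition rat_comb :: "'k::number_field list \<Rightarrow> (nat \<Rightarrow> rat) \<Rightarrow> 'k" where
  "rat_comb a q = (\<Sum>i<length a. a ! i * of_rat (q i))"

lemma field_degree_eq_dim: "field_degree TYPE('k::number_field) = Q.dim (UNIV :: 'k set)"
  by (simp add: field_degree_def)

lemma finite_rat_spanning_set: "\<exists>B::'k::number_field set. finite B \<and> Q.span B = UNIV"
proof -
  obtain B :: "'k set" where B: "finite B" "\<forall>x. \<exists>c. x = (\<Sum>b\<in>B. of_rat (c b) * b)"
    using finite_dim_over_rat by blast
  have "x \<in> Q.span B" for x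
  proof -
    obtain c where "x = (\<Sum>b\<in>B. of_rat (c b) * b)" using B(2) by blast
    thus ?thesis by (simp add: Q.span_sum Q.span_scale Q.span_base)
  qed
  thus ?thesis using B(1) by blast
qed

lemma finite_if_rat_independent: "Q.independent (S :: 'k::number_field set) \<Longrightarrow> finite S"
proof -
  assume S: "Q.independent S"
  obtain B :: "'k set" where "finite B" "Q.span B = UNIV" using finite_rat_spanning_set by blast
  thus "finite S" using Q.independent_span_bound[OF _ S] by auto
qed

lemma card_rat_basis:
  "Q.independent B \<Longrightarrow> Q.span B = UNIV \<Longrightarrow> card (B :: 'k::number_field set) = field_degree TYPE('k)"
  unfolding field_degree_eq_dim by (rule Q.basis_card_eq_dim) auto

lemma rat_basis_if_card:
  assumes "Q.independent B" "card (B :: 'k::number_field set) = field_degree TYPE('k)"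
  shows "Q.span B = UNIV"
proof -
  obtain C where C: "B \<subseteq> C" "Q.independent C" "UNIV \<subseteq> Q.span C"
    by (rule Q.maximal_independent_subset_extend[OF subset_UNIV assms(1)])
  have "Q.span C = UNIV" using C(3) by blast
  hence "card C = card B" using card_rat_basis[OF C(2)] assms(2) by simp
  hence "B = C" using card_subset_eq[OF finite_if_rat_independent[OF C(2)] C(1)] by simp
  thus ?thesis using C(3) by blast
qed

lemma rat_comb_eq_sum_set:
  assumes "distinct a"
  shows "(\<Sum>b\<in>set a. of_rat (c b) * b) = rat_comb a (\<lambda>i. c (a ! i))"
  unfolding rat_comb_def using assms
  by (subst sum.reindex_bij_betw[symmetric, OF bij_betw_nth[OF assms refl refl]])
     (simp add: mult.commute)

lemma rat_comb_spans:
  assumes "Q.span (set a) = (UNIV :: 'k::number_field set)"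
  shows "\<exists>q. x = rat_comb a q"
proof -
  have "x \<in> Q.span (set (remdups a))" using assms by simp
  then obtain c where c: "x = (\<Sum>b\<in>set a. of_rat (c b) * b)"
    by (auto simp: Q.span_finite)
  (* Entries of a may repeat; only one chosen position of each value gets a nonzero coefficient. *)
  define r where "r b = (SOME i. i < length a \<and> a ! i = b)" for b
  have r: "r b < length a \<and> a ! r b = b" if "b \<in> set a" for b
    using that unfolding r_def in_set_conv_nth by (rule someI_ex)
  have inj: "inj_on r (set a)"
  proof (rule inj_onI)
    fix b c assume "b \<in> set a" "c \<in> set a" "r b = r c"
    thus "b = c" using r by metis
  qed
  have "rat_comb a (\<lambda>i. if i \<in> r ` set a then c (a ! i) else 0)
      = (\<Sum>i\<in>r ` set a. a ! i * of_rat (c (a ! i)))"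
    unfolding rat_comb_def using r by (intro sum.mono_neutral_cong_right) auto
  also have "\<dots> = x" unfolding c
    by (subst sum.reindex[OF inj]) (auto intro!: sum.cong simp: r)
  finally show ?thesis by (intro exI) (rule sym)
qed

lemma rat_comb_basis:
  assumes "length a = field_degree TYPE('k)"
    and indep: "\<And>q. rat_comb a q = 0 \<Longrightarrow> \<forall>i<length a. q i = 0"
  shows "Q.span (set a) = (UNIV :: 'k::number_field set)"
proof -
  have dist: "distinct a"
  proof (rule ccontr)
    assume "\<not> distinct a"
    then obtain i j where ij: "i < length a" "j < length a" "i \<noteq> j" "a ! i = a ! j"
      by (auto simp: distinct_conv_nth)
    (* A repeated entry is a linear relation with coefficients 1 and -1. *)
    define q :: "nat \<Rightarrow> rat" where "q l = (if l = i then 1 else if l = j then -1 else 0)" for l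
    have "rat_comb a q = (\<Sum>l<length a. (if l = i then a ! i else 0) - (if l = j then a ! j else 0))"
      unfolding rat_comb_def q_def using ij by (intro sum.cong) auto
    also have "\<dots> = 0" using ij by (simp add: sum_subtractf)
    finally show False using indep[of q] ij by (auto simp: q_def)
  qed
  have "Q.independent (set a)"
  proof (rule Q.independent_if_scalars_zero)
    fix f x assume f: "(\<Sum>x\<in>set a. of_rat (f x) * x) = 0" and "x \<in> set a"
    thus "f x = 0"
      using indep[of "\<lambda>i. f (a ! i)"] rat_comb_eq_sum_set[OF dist, of f] by (auto simp: in_set_conv_nth)
  qed simp
  thus ?thesis by (rule rat_basis_if_card) (simp add: distinct_card[OF dist] assms(1))
qed

section \<open>Determinants of embeddings\<close>

text \<open>
  The square of this determinant is the discriminant. The determinant itself is linear in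
  each entry of the tuple, and this linearity is what the arguments below live on.
\<close>

definition emb_det :: "('k::number_field \<Rightarrow> real) list \<Rightarrow> 'k list \<Rightarrow> real" where
  "emb_det \<sigma> a = Determinant.det (mat (length \<sigma>) (length \<sigma>) (\<lambda>(j, k). (\<sigma> ! j) (a ! k)))"

lemma sqrt_disc: "sqrt \<bar>disc \<sigma> a\<bar> = \<bar>emb_det \<sigma> a\<bar>"
  by (simp add: disc_def emb_det_def)

lemma field_hom_mult: "field_hom \<tau> \<Longrightarrow> \<tau> (x * y) = \<tau> x * \<tau> y"
proof -
  assume "field_hom \<tau>"
  then interpret field_hom \<tau> .
  show ?thesis by (rule hom_mult)
qed

lemma field_hom_of_rat:
  fixes \<tau> :: "'k::number_field \<Rightarrow> real"
  assumes "field_hom \<tau>" shows "\<tau> (of_rat q) = of_rat q"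
proof -
  interpret field_hom \<tau> by fact
  have i: "\<tau> (of_int n) = of_int n" for n
  proof -
    have "\<tau> (of_nat m) = of_nat m" for m by (induction m) (simp_all add: hom_distribs)
    thus ?thesis by (cases n) (simp_all add: hom_distribs)
  qed
  show ?thesis
    by (cases q) (simp add: of_rat_rat hom_distribs i)
qed

lemma field_hom_rat_comb:
  assumes "field_hom (\<tau> :: 'k::number_field \<Rightarrow> real)"
  shows "\<tau> (rat_comb a q) = (\<Sum>i<length a. \<tau> (a ! i) * of_rat (q i))"
proof -
  interpret field_hom \<tau> by fact
  show ?thesis by (simp add: rat_comb_def hom_distribs field_hom_of_rat[OF assms])
qed

text \<open>
  Dedekind's elimination: a relation evaluated at \<open>y * x\<close>, minus \<open>\<rho> y\<close> times the relation
  evaluated at \<open>x\<close>, no longer contains \<open>\<rho>\<close>, and the coefficient of \<open>\<tau>\<close> in it is nonzero unless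
  \<open>w \<tau> = 0\<close>, provided \<open>y\<close> separates \<open>\<tau>\<close> from \<open>\<rho>\<close>.
\<close>

lemma dedekind_independence:
  fixes S :: "('k::number_field \<Rightarrow> real) set"
  assumes "finite S" "\<And>\<tau>. \<tau> \<in> S \<Longrightarrow> field_hom \<tau>" "\<And>x. (\<Sum>\<tau>\<in>S. w \<tau> * \<tau> x) = 0" "\<tau> \<in> S"
  shows "w \<tau> = 0"
  using assms
proof (induction S arbitrary: w \<tau> rule: finite_induct)
  case (insert \<rho> S)
  have hom: "field_hom \<tau>" if "\<tau> \<in> insert \<rho> S" for \<tau> using insert.prems(1) that .
  interpret \<rho>: field_hom \<rho> by (rule hom) simp
  have rel: "w \<rho> * \<rho> x + (\<Sum>\<tau>\<in>S. w \<tau> * \<tau> x) = 0" for x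
    using insert.prems(2)[of x] insert.hyps by simp
  have zero: "w \<tau> = 0" if \<tau>: "\<tau> \<in> S" for \<tau>
  proof -
    have "\<tau> \<noteq> \<rho>" using insert.hyps(2) \<tau> by blast
    then obtain y where y: "\<tau> y \<noteq> \<rho> y" by (auto simp: fun_eq_iff)
    have rel': "(\<Sum>\<tau>\<in>S. w \<tau> * (\<tau> y - \<rho> y) * \<tau> x) = 0" for x
    proof -
      have "(\<Sum>\<tau>\<in>S. w \<tau> * (\<tau> y - \<rho> y) * \<tau> x)
          = (\<Sum>\<tau>\<in>S. w \<tau> * \<tau> (y * x)) - \<rho> y * (\<Sum>\<tau>\<in>S. w \<tau> * \<tau> x)"
        unfolding sum_distrib_left sum_subtractf[symmetric]
      proof (intro sum.cong refl)
        fix \<tau> assume "\<tau> \<in> S"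
        hence "\<tau> (y * x) = \<tau> y * \<tau> x" using hom by (intro field_hom_mult) simp
        thus "w \<tau> * (\<tau> y - \<rho> y) * \<tau> x = w \<tau> * \<tau> (y * x) - \<rho> y * (w \<tau> * \<tau> x)"
          by (simp add: algebra_simps)
      qed
      also have "\<dots> = - (w \<rho> * \<rho> (y * x)) - \<rho> y * - (w \<rho> * \<rho> x)"
        using rel[of "y * x"] rel[of x] by (simp only: add_eq_0_iff minus_minus)
      also have "\<dots> = 0" by (simp add: \<rho>.hom_mult)
      finally show ?thesis .
    qed
    have "w \<tau> * (\<tau> y - \<rho> y) = 0"
      by (rule insert.IH[OF hom rel' \<tau>]) simp
    thus ?thesis using y by simp
  qed
  hence "(\<Sum>\<tau>\<in>S. w \<tau> * \<tau> 1) = 0" by (intro sum.neutral) simp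
  hence "w \<rho> = 0" using rel[of 1] by simp
  thus ?case using zero insert.prems(3) by blast
qed simp

text \<open>
  A number field is totally real precisely if it has as many real embeddings as its degree
  indicates. Then the matrix of the values of the embeddings at a tuple of that length is square.
\<close>

locale full_embeddings =
  fixes \<sigma> :: "('k::number_field \<Rightarrow> real) list"
  assumes hom: "\<And>\<tau>. \<tau> \<in> set \<sigma> \<Longrightarrow> field_hom \<tau>"
    and distinct: "distinct \<sigma>"
    and length: "length \<sigma> = field_degree TYPE('k)"
begin

abbreviation d where "d \<equiv> length \<sigma>"
abbreviation D where "D \<equiv> emb_det \<sigma>"

lemma hom_nth: "j < d \<Longrightarrow> field_hom (\<sigma> ! j)"
  by (simp add: hom)

text \<open>
  Cramer's rule: rational coordinates with respect to a tuple are ratios of determinants, because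
  the embeddings fix the rationals and so turn coordinates in the field into coordinates of real
  column vectors.
\<close>

lemma emb_det_replace:
  assumes a: "length a = d" and k: "k < d"
  shows "D (a[k := rat_comb a q]) = of_rat (q k) * D a"
proof -
  let ?A = "mat d d (\<lambda>(j, k). (\<sigma> ! j) (a ! k))"
  let ?q = "vec d (\<lambda>i. of_rat (q i) :: real)"
  have "mat d d (\<lambda>(j, l). (\<sigma> ! j) (a[k := rat_comb a q] ! l)) = replace_col ?A (?A *\<^sub>v ?q) k"
    using a k by (auto intro!: eq_matI
      simp: replace_col_def nth_list_update field_hom_rat_comb[OF hom_nth] scalar_prod_def atLeast0LessThan)
  thus ?thesis unfolding emb_det_def using cramer_lemma_mat[of ?A d ?q k] k by simp
qed

lemma emb_det_change:
  assumes a: "length a = d" and g: "\<And>k. k < d \<Longrightarrow> g ! k = rat_comb a (\<lambda>i. c i k)"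
  shows "D g = D a * of_rat (Determinant.det (mat d d (\<lambda>(i, k). c i k)))"
proof -
  let ?A = "mat d d (\<lambda>(j, k). (\<sigma> ! j) (a ! k))" and ?C = "mat d d (\<lambda>(i, k). c i k)"
  have "mat d d (\<lambda>(j, l). (\<sigma> ! j) (g ! l)) = ?A * map_mat of_rat ?C"
    using a by (auto intro!: eq_matI
      simp: g field_hom_rat_comb[OF hom_nth] scalar_prod_def atLeast0LessThan)
  hence "D g = D a * Determinant.det (map_mat of_rat ?C)"
    unfolding emb_det_def by (simp add: det_mult[of _ d])
  thus ?thesis by (simp add: of_rat_hom.hom_det)
qed

lemma rat_comb_eq_0D:
  assumes a: "length a = d" "D a \<noteq> 0" and 0: "rat_comb a q = 0" and i: "i < d"
  shows "q i = 0"
proof -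
  have "D (a[i := 0]) = of_rat (q i) * D a"
    using emb_det_replace[OF a(1) i, of q] 0 by simp
  moreover have "a[i := 0] = a[i := rat_comb a (\<lambda>_. 0)]" by (simp add: rat_comb_def)
  hence "D (a[i := 0]) = 0" using emb_det_replace[OF a(1) i, of "\<lambda>_. 0"] by simp
  ultimately show ?thesis using a(2) by simp
qed

lemma rat_comb_surj:
  assumes a: "length a = d" "D a \<noteq> 0"
  shows "\<exists>q. x = rat_comb a q"
proof (rule rat_comb_spans, rule rat_comb_basis)
  show "length a = field_degree TYPE('k)" using a(1) length by simp
qed (use rat_comb_eq_0D[OF a] a(1) in auto)

text \<open>
  If the determinant vanished, its rows would satisfy a linear relation. It would hold at a
  rational basis, hence on the whole field, against the independence of the embeddings.
\<close>

lemma emb_det_basis_nonzero: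
  assumes a: "length a = d" "Q.span (set a) = UNIV"
  shows "D a \<noteq> 0"
proof
  let ?A = "mat d d (\<lambda>(j, k). (\<sigma> ! j) (a ! k))"
  assume "D a = 0"
  hence "Determinant.det (transpose_mat ?A) = 0"
    unfolding emb_det_def by (subst det_transpose[of _ d]) auto
  then obtain w where w: "w \<in> carrier_vec d" "w \<noteq> 0\<^sub>v d" "transpose_mat ?A *\<^sub>v w = 0\<^sub>v d"
    using det_0_iff_vec_prod_zero[of "transpose_mat ?A" d] by auto
  have col: "(\<Sum>j<d. (\<sigma> ! j) (a ! k) * vec_index w j) = 0" if "k < d" for k
    using that w(1) arg_cong[OF w(3), of "\<lambda>v. vec_index v k"]
    by (simp add: scalar_prod_def atLeast0LessThan)
  have "(\<Sum>j<d. vec_index w j * (\<sigma> ! j) x) = 0" for x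
  proof -
    obtain q where x: "x = rat_comb a q" using rat_comb_spans a by blast
    have "(\<Sum>j<d. vec_index w j * (\<sigma> ! j) x)
        = (\<Sum>j<d. \<Sum>k<d. of_rat (q k) * ((\<sigma> ! j) (a ! k) * vec_index w j))"
      by (simp add: x a(1) field_hom_rat_comb[OF hom_nth] sum_distrib_left mult_ac)
    also have "\<dots> = (\<Sum>k<d. of_rat (q k) * (\<Sum>j<d. (\<sigma> ! j) (a ! k) * vec_index w j))"
      by (subst sum.swap) (simp add: sum_distrib_left)
    also have "\<dots> = 0" using col by simp
    finally show ?thesis .
  qed
  (* The relation w indexed by positions becomes a relation W indexed by the embeddings
     themselves; each embedding has only one position. *)
  moreover define W where "W \<tau> = vec_index w (THE j. j < d \<and> \<sigma> ! j = \<tau>)" for \<tau>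
  have W: "W (\<sigma> ! j) = vec_index w j" if "j < d" for j
  proof -
    have "(THE i. i < d \<and> \<sigma> ! i = \<sigma> ! j) = j"
      using that distinct nth_eq_iff_index_eq by (intro the_equality) auto
    thus ?thesis by (simp add: W_def)
  qed
  have "(\<Sum>\<tau>\<in>set \<sigma>. W \<tau> * \<tau> x) = (\<Sum>j<d. vec_index w j * (\<sigma> ! j) x)" for x
    by (subst sum.reindex_bij_betw[symmetric, OF bij_betw_nth[OF distinct refl refl]])
       (simp add: W)
  ultimately have rel: "(\<Sum>\<tau>\<in>set \<sigma>. W \<tau> * \<tau> x) = 0" for x by metis
  have "W \<tau> = 0" if "\<tau> \<in> set \<sigma>" for \<tau>
    by (rule dedekind_independence[OF _ hom rel that]) auto
  hence "vec_index w j = 0" if "j < d" for j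
    using W[OF that] that by (metis nth_mem)
  hence "w = 0\<^sub>v d" using carrier_vecD[OF w(1)] by (intro eq_vecI) simp_all
  thus False using w(2) by simp
qed

end

section \<open>Integral bases and the field discriminant\<close>

lemma common_denominator:
  assumes "finite (F :: rat set)"
  shows "\<exists>N::int. N > 0 \<and> (\<forall>q\<in>F. of_int N * q \<in> \<int>)"
  using assms
proof (induction F)
  case empty
  show ?case by (intro exI[of _ 1]) simp
next
  case (insert r F)
  then obtain N :: int where N: "N > 0" "\<forall>q\<in>F. of_int N * q \<in> \<int>" by blast
  obtain n m where r: "r = of_int n / of_int m" "m > 0"
    by (metis Fract_of_int_quotient Rat_cases)
  show ?case
  proof (intro exI[of _ "m * N"] conjI ballI)
    fix q assume "q \<in> insert r F"
    moreover have "of_int (m * N) * r = of_int (n * N)" using r by simp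
    moreover have "of_int (m * N) * q = of_int m * (of_int N * q)" by simp
    ultimately show "of_int (m * N) * q \<in> \<int>"
      using N(2) by (metis Ints_mult Ints_of_int insertE)
  qed (use N r in simp)
qed

lemma rat_basis_list:
  assumes "Q.span V = (UNIV :: 'k::number_field set)"
  obtains b where "set b \<subseteq> V" "distinct b" "length b = field_degree TYPE('k)" "Q.span (set b) = UNIV"
proof -
  obtain B where B: "{} \<subseteq> B" "B \<subseteq> V" "Q.independent B" "V \<subseteq> Q.span B"
    by (rule Q.maximal_independent_subset_extend[OF empty_subsetI Q.independent_empty])
  have span: "Q.span B = UNIV"
    using Q.span_mono[OF B(4)] assms Q.span_span by blast
  obtain b where "set b = B" "distinct b"
    using finite_distinct_list[OF finite_if_rat_independent[OF B(3)]] by blast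
  thus ?thesis
    using that[of b] B(2) span card_rat_basis[OF B(3) span] distinct_card[of b] by simp
qed

lemma field_degree_pos: "field_degree TYPE('k::number_field) > 0"
proof (rule ccontr)
  assume nonpos: "\<not> ?thesis"
  obtain b :: "'k list" where "length b = field_degree TYPE('k)" "Q.span (set b) = UNIV"
    by (rule rat_basis_list[OF Q.span_UNIV])
  hence "Q.span {} = (UNIV :: 'k set)" using nonpos by simp
  thus False by (metis Q.span_empty UNIV_I singletonD zero_neq_one)
qed

text \<open>
  Multiplication by \<open>x\<close> has a rational matrix in a rational basis. Once the denominators are
  cleared by \<open>N\<close>, the product \<open>N * x\<close> is an eigenvalue of an integer matrix, and hence a root of
  its characteristic polynomial, which is monic with integer coefficients.
\<close>

lemma algebraic_int_multiple:
  "\<exists>N::int. N > 0 \<and> algebraic_int (of_int N * (x::'k::number_field))"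
proof -
  obtain b :: "'k list" where len: "length b = field_degree TYPE('k)" and span: "Q.span (set b) = UNIV"
      and dist: "distinct b"
    by (rule rat_basis_list[OF Q.span_UNIV])
  define d where "d = length b"
  have "\<forall>k. \<exists>q. x * b ! k = rat_comb b q" using rat_comb_spans[OF span] by blast
  then obtain q where q: "x * b ! k = rat_comb b (q k)" for k by metis
  obtain N :: int where N: "N > 0" "\<forall>r\<in>(\<lambda>(k, i). q k i) ` ({..<d} \<times> {..<d}). of_int N * r \<in> \<int>"
    using common_denominator by (metis finite_SigmaI finite_imageI finite_lessThan)
  define M where "M = mat d d (\<lambda>(k, i). \<lfloor>of_int N * q k i\<rfloor>)"
  have M: "of_int \<lfloor>of_int N * q k i\<rfloor> = (of_int N * of_rat (q k i) :: 'k)" if "k < d" "i < d" for k i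
  proof -
    have "of_int N * q k i \<in> \<int>" using N(2) that by force
    hence "of_int \<lfloor>of_int N * q k i\<rfloor> = of_int N * q k i" by (rule of_int_floor)
    hence "of_rat (of_int \<lfloor>of_int N * q k i\<rfloor>) = (of_rat (of_int N * q k i) :: 'k)" by (rule arg_cong)
    thus ?thesis by (simp add: of_rat_mult)
  qed
  let ?A = "map_mat of_int M :: 'k mat" and ?v = "vec d (\<lambda>k. b ! k)"
  have A: "?A \<in> carrier_mat d d" by (simp add: M_def)
  (* The basis itself, as a vector over the field, is the eigenvector. *)
  have "?A *\<^sub>v ?v = (of_int N * x) \<cdot>\<^sub>v ?v"
  proof (rule eq_vecI)
    fix k assume "k < dim_vec ((of_int N * x) \<cdot>\<^sub>v ?v)"
    hence k: "k < d" by simp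
    have "vec_index (?A *\<^sub>v ?v) k = (\<Sum>i<d. of_int \<lfloor>of_int N * q k i\<rfloor> * b ! i)"
      using k by (simp add: M_def scalar_prod_def atLeast0LessThan)
    also have "\<dots> = of_int N * rat_comb b (q k)"
      using k by (simp add: M rat_comb_def sum_distrib_left mult_ac flip: d_def)
    also have "\<dots> = vec_index ((of_int N * x) \<cdot>\<^sub>v ?v) k"
      using k by (simp add: q[symmetric] mult_ac)
    finally show "vec_index (?A *\<^sub>v ?v) k = vec_index ((of_int N * x) \<cdot>\<^sub>v ?v) k" .
  qed (simp add: M_def)
  moreover have "?v \<noteq> 0\<^sub>v d"
  proof
    assume "?v = 0\<^sub>v d"
    hence "b ! k = 0" if "k < d" for k using that by (metis index_vec index_zero_vec(1))
    hence "rat_comb b q = 0" for q by (simp add: rat_comb_def d_def)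
    thus False using rat_comb_spans[OF span, of 1] by simp
  qed
  ultimately have "eigenvalue ?A (of_int N * x)"
    unfolding eigenvalue_def eigenvector_def using A by (intro exI[of _ ?v]) auto
  hence "poly (char_poly ?A) (of_int N * x) = 0"
    using eigenvalue_root_char_poly[OF A] by simp
  moreover have "char_poly ?A = map_poly of_int (char_poly M)"
    by (rule of_int_hom.char_poly_hom) (auto simp: M_def)
  moreover have "lead_coeff (char_poly M) = 1"
    using degree_monic_char_poly[of M d] by (simp add: M_def)
  ultimately have "algebraic_int (of_int N * x)"
    unfolding algebraic_int_altdef_ipoly by metis
  thus ?thesis using N(1) by blast
qed

lemma int_comb_eq_rat_comb: "int_comb a c = rat_comb a (\<lambda>i. of_int (c ! i))"
  by (simp add: int_comb_def rat_comb_def)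

lemma rat_comb_in_span: "rat_comb a q \<in> Q.span (set a)"
proof -
  have "rat_comb a q = (\<Sum>i<length a. of_rat (q i) * a ! i)" by (simp add: rat_comb_def mult.commute)
  also have "\<dots> \<in> Q.span (set a)"
    by (intro Q.span_sum Q.span_scale Q.span_base) simp
  finally show ?thesis .
qed

lemma rat_span_eq_UNIV_if_generates_integers:
  assumes "ring_of_integers = int_span (\<alpha> :: 'k::number_field list)"
  shows "Q.span (set \<alpha>) = UNIV"
proof (intro equalityI subsetI UNIV_I)
  fix x :: 'k
  obtain N :: int where N: "N > 0" "algebraic_int (of_int N * x)" using algebraic_int_multiple by blast
  hence "of_int N * x \<in> int_span \<alpha>" using assms by (auto simp: ring_of_integers_def)
  hence "of_int N * x \<in> Q.span (set \<alpha>)"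
    by (auto simp: int_span_def int_comb_eq_rat_comb rat_comb_in_span)
  hence "of_rat (1 / of_int N) * (of_int N * x) \<in> Q.span (set \<alpha>)" by (rule Q.span_scale)
  moreover have "of_rat (1 / of_int N) * (of_int N * x) = x" using N by (simp add: of_rat_divide)
  ultimately show "x \<in> Q.span (set \<alpha>)" by simp
qed

lemma int_span_lincomb:
  assumes "x \<in> int_span \<alpha>" "y \<in> int_span \<alpha>"
  shows "x + of_int n * y \<in> int_span \<alpha>"
proof -
  obtain c e where ce: "length c = length \<alpha>" "length e = length \<alpha>" "x = int_comb \<alpha> c" "y = int_comb \<alpha> e"
    using assms by (auto simp: int_span_def)
  have "x + of_int n * y = int_comb \<alpha> (map (\<lambda>i. c ! i + n * e ! i) [0..<length \<alpha>])"
    by (simp add: ce int_comb_def sum.distrib[symmetric] sum_distrib_left algebra_simps)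
  thus ?thesis by (auto simp: int_span_def)
qed

lemma rat_comb_int_in_int_span:
  assumes "set a \<subseteq> int_span \<alpha>"
  shows "rat_comb a (\<lambda>i. of_int (c i)) \<in> int_span \<alpha>"
proof -
  have zero: "0 \<in> int_span \<alpha>"
    by (auto simp: int_span_def int_comb_def intro!: image_eqI[of _ _ "replicate (length \<alpha>) 0"])
  have "(\<Sum>i<n. a ! i * of_int (c i)) \<in> int_span \<alpha>" if "n \<le> length a" for n
    using that
  proof (induction n)
    case (Suc n)
    hence "a ! n \<in> int_span \<alpha>" using assms by auto
    thus ?case using int_span_lincomb[OF Suc.IH, of "a ! n" "c n"] Suc.prems by (simp add: mult.commute)
  qed (simp add: zero)
  thus ?thesis by (simp add: rat_comb_def)
qed

context full_embeddings
begin

lemma emb_det_change_int: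
  assumes "length a = d" and "\<And>k. k < d \<Longrightarrow> \<exists>c. g ! k = rat_comb a (\<lambda>i. of_int (c i))"
  shows "\<exists>z::int. D g = D a * of_int z"
proof -
  obtain m where m: "g ! k = rat_comb a (\<lambda>i. of_int (m k i))" if "k < d" for k
    using assms(2) by metis
  let ?M = "mat d d (\<lambda>(i, k). m k i)"
  have "mat d d (\<lambda>(i, k). of_int (m k i) :: rat) = map_mat of_int ?M" by auto
  hence "Determinant.det (mat d d (\<lambda>(i, k). of_int (m k i) :: rat)) = of_int (Determinant.det ?M)"
    by (simp add: of_int_hom.hom_det)
  thus ?thesis using emb_det_change[OF assms(1), of g "\<lambda>i k. of_int (m k i)"] m by auto
qed

lemma emb_det_integral_basis_multiple:
  assumes "integral_basis \<omega>" "length \<omega> = d" "length g = d" "set g \<subseteq> ring_of_integers"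
  shows "\<exists>z::int. D g = D \<omega> * of_int z"
proof (rule emb_det_change_int[OF assms(2)])
  fix k assume "k < d"
  hence "g ! k \<in> int_comb \<omega> ` {c. length c = length \<omega>}"
    using assms by (auto simp: integral_basis_def bij_betw_def)
  thus "\<exists>c. g ! k = rat_comb \<omega> (\<lambda>i. of_int (c i))"
    by (auto simp: int_comb_eq_rat_comb)
qed

context
  fixes \<alpha> :: "'k list"
  assumes gen: "ring_of_integers = int_span \<alpha>" and int: "set \<alpha> \<subseteq> ring_of_integers"
begin

lemma integral_tuple_exists:
  obtains a where "set a \<subseteq> ring_of_integers" "length a = d" "D a \<noteq> 0"
proof -
  obtain a where "set a \<subseteq> set \<alpha>" "length a = field_degree TYPE('k)" "Q.span (set a) = UNIV"
    by (rule rat_basis_list[OF rat_span_eq_UNIV_if_generates_integers[OF gen]])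
  thus ?thesis using that[of a] int emb_det_basis_nonzero[of a] length by auto
qed

text \<open>
  A rational basis \<open>a\<close>, divided by a common denominator of the coordinates of the finitely many
  generators, generates a lattice that contains all integers of the field. So the determinants
  of integral tuples are integer multiples of that of the divided basis. This discreteness makes
  the minimal choice in the next lemma possible.
\<close>

lemma emb_det_discrete:
  obtains \<delta> where "\<delta> \<noteq> 0"
    "\<And>g. length g = d \<Longrightarrow> set g \<subseteq> ring_of_integers \<Longrightarrow> \<exists>z::int. D g = \<delta> * of_int z"
proof -
  obtain a where a: "set a \<subseteq> ring_of_integers" "length a = d" "D a \<noteq> 0"
    by (rule integral_tuple_exists)
  have "\<forall>i. \<exists>q. \<alpha> ! i = rat_comb a q" using rat_comb_surj[OF a(2,3)] by blast
  then obtain q where q: "\<alpha> ! i = rat_comb a (q i)" for i by metis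
  obtain N :: int where N: "N > 0"
      "\<forall>r\<in>(\<lambda>(i, l). q i l) ` ({..<length \<alpha>} \<times> {..<d}). of_int N * r \<in> \<int>"
    using common_denominator by (metis finite_SigmaI finite_imageI finite_lessThan)
  have Nq: "of_int \<lfloor>of_int N * q i l\<rfloor> = of_int N * q i l" if "i < length \<alpha>" "l < d" for i l
    using N(2) that by (intro of_int_floor) force
  define b where "b = map (\<lambda>x. x * of_rat (1 / of_int N)) a"
  have len: "length b = d" by (simp add: b_def a)
  have b: "rat_comb b (\<lambda>i. of_int N * r i) = rat_comb a r" for r
    unfolding rat_comb_def using N(1)
    by (auto simp: b_def of_rat_mult of_rat_divide intro!: sum.cong)
  have "x \<in> Q.span (set b)" for x
    using rat_comb_surj[OF a(2,3), of x] rat_comb_in_span[of b] by (auto simp flip: b)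
  hence "D b \<noteq> 0" by (intro emb_det_basis_nonzero len) blast
  moreover have "\<exists>z::int. D g = D b * of_int z" if g: "length g = d" "set g \<subseteq> ring_of_integers" for g
  proof (rule emb_det_change_int[OF len])
    fix k assume "k < d"
    hence "g ! k \<in> int_span \<alpha>" using g gen by auto
    then obtain c where "g ! k = int_comb \<alpha> c" by (auto simp: int_span_def)
    also have "\<dots> = (\<Sum>i<length \<alpha>. \<Sum>l<d. a ! l * of_rat (q i l) * of_int (c ! i))"
      by (simp add: int_comb_def q rat_comb_def sum_distrib_right a(2))
    also have "\<dots> = (\<Sum>l<d. \<Sum>i<length \<alpha>. a ! l * of_rat (q i l) * of_int (c ! i))"
      by (rule sum.swap)
    also have "\<dots> = rat_comb a (\<lambda>l. \<Sum>i<length \<alpha>. q i l * of_int (c ! i))"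
      by (simp add: rat_comb_def a(2) sum_distrib_left of_rat_sum of_rat_mult mult.assoc)
    also have "\<dots> = rat_comb b (\<lambda>l. of_int (\<Sum>i<length \<alpha>. \<lfloor>of_int N * q i l\<rfloor> * c ! i))"
      unfolding b[symmetric] unfolding rat_comb_def
      by (intro sum.cong refl) (simp add: Nq len sum_distrib_left mult.assoc)
    finally show "\<exists>c. g ! k = rat_comb b (\<lambda>i. of_int (c i))"
      by (intro exI[of _ "\<lambda>l. \<Sum>i<length \<alpha>. \<lfloor>of_int N * q i l\<rfloor> * c ! i"])
  qed
  ultimately show ?thesis by (rule that)
qed

text \<open>
  An integral tuple \<open>\<omega>\<close> whose determinant is nonzero and of least absolute value is an integral
  basis: if an integer had a nonintegral coordinate \<open>q j\<close>, then reducing that coordinate to its fractional part and putting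
  the result in place of \<open>\<omega> ! j\<close> would, by Cramer's rule, multiply the determinant by a factor
  strictly between 0 and 1.
\<close>

lemma integral_basis_exists:
  obtains \<omega> where "length \<omega> = d" "integral_basis \<omega>" "D \<omega> \<noteq> 0" "set \<omega> \<subseteq> ring_of_integers"
proof -
  obtain \<delta> where \<delta>: "\<delta> \<noteq> 0"
    "\<And>g. length g = d \<Longrightarrow> set g \<subseteq> ring_of_integers \<Longrightarrow> \<exists>z::int. D g = \<delta> * of_int z"
    by (rule emb_det_discrete) blast
  define P where "P g \<longleftrightarrow> length g = d \<and> set g \<subseteq> ring_of_integers \<and> D g \<noteq> 0" for g
  (* The determinant is an integer multiple of \<delta>; ix is the absolute value of that integer. *)
  define ix where "ix g = nat (floor (\<bar>D g / \<delta>\<bar>))" for g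
  have ix: "real (ix g) = \<bar>D g / \<delta>\<bar>" if g: "P g" for g
  proof -
    obtain z :: int where "D g = \<delta> * of_int z" using \<delta>(2)[of g] g unfolding P_def by blast
    hence "\<bar>D g / \<delta>\<bar> = of_int \<bar>z\<bar>" using \<delta>(1) by simp
    thus ?thesis by (simp add: ix_def)
  qed
  obtain a where "P a" using integral_tuple_exists unfolding P_def by metis
  then obtain \<omega> where \<omega>: "P \<omega>" "\<And>g. P g \<Longrightarrow> ix \<omega> \<le> ix g"
    using ex_has_least_nat[of P a ix] by blast
  hence len: "length \<omega> = d" and D: "D \<omega> \<noteq> 0" and int\<omega>: "set \<omega> \<subseteq> ring_of_integers"
    by (auto simp: P_def)
  have "q j \<in> \<int>" if q: "rat_comb \<omega> q \<in> ring_of_integers" and j: "j < d" for q j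
  proof (rule ccontr)
    assume nonint: "q j \<notin> \<int>"
    define r where "r = (\<lambda>i. if i = j then frac (q j) else q i)"
    have "rat_comb \<omega> r = (\<Sum>i<length \<omega>. \<omega> ! i * of_rat (q i)
        + (if i = j then of_int (- \<lfloor>q j\<rfloor>) * \<omega> ! j else 0))"
      unfolding rat_comb_def r_def
      by (intro sum.cong) (auto simp: frac_def of_rat_diff algebra_simps)
    also have "\<dots> = rat_comb \<omega> q + of_int (- \<lfloor>q j\<rfloor>) * \<omega> ! j"
      using j len by (simp add: sum.distrib rat_comb_def)
    also have "\<dots> \<in> ring_of_integers"
      unfolding gen using q int\<omega> j len gen by (intro int_span_lincomb) auto
    finally have r: "rat_comb \<omega> r \<in> ring_of_integers" .
    have Dr: "D (list_update \<omega> j (rat_comb \<omega> r)) = of_rat (frac (q j)) * D \<omega>"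
      using emb_det_replace[OF len j, of r] by (simp add: r_def)
    have frac: "0 < frac (q j)" "frac (q j) < 1" using nonint by (simp_all add: frac_lt_1)
    hence "P (list_update \<omega> j (rat_comb \<omega> r))"
      using Dr D int\<omega> r len unfolding P_def using set_update_subset_insert[of \<omega> j "rat_comb \<omega> r"] by auto
    hence "\<bar>D \<omega> / \<delta>\<bar> \<le> \<bar>of_rat (frac (q j)) * D \<omega> / \<delta>\<bar>"
      using \<omega>(2) ix \<omega>(1) Dr by (metis of_nat_le_iff)
    also have "\<dots> = of_rat (frac (q j)) * \<bar>D \<omega> / \<delta>\<bar>"
      using frac by (simp add: abs_mult abs_divide)
    also have "\<dots> < 1 * \<bar>D \<omega> / \<delta>\<bar>"
      using frac D \<delta>(1) by (intro mult_strict_right_mono) auto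
    finally show False by simp
  qed note integral = this
  have "integral_basis \<omega>"
    unfolding integral_basis_def
  proof (intro bij_betw_imageI inj_onI equalityI subsetI)
    fix c e assume ce: "c \<in> {c. length c = length \<omega>}" "e \<in> {c. length c = length \<omega>}"
      "int_comb \<omega> c = int_comb \<omega> e"
    have "rat_comb \<omega> (\<lambda>i. of_int (c ! i - e ! i)) = 0"
      using ce(3) by (simp add: int_comb_def rat_comb_def of_rat_diff algebra_simps sum_subtractf)
    from rat_comb_eq_0D[OF len D this] have "c ! i = e ! i" if "i < d" for i
      using that by fastforce
    thus "c = e" using ce len by (auto intro!: nth_equalityI)
  next
    fix x assume "x \<in> int_comb \<omega> ` {c. length c = length \<omega>}"
    thus "x \<in> ring_of_integers"
      using rat_comb_int_in_int_span[of \<omega> \<alpha>] int\<omega> gen by (auto simp: int_comb_eq_rat_comb)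
  next
    fix x assume x: "x \<in> (ring_of_integers :: 'k set)"
    obtain q where q: "x = rat_comb \<omega> q" using rat_comb_surj[OF len D] by blast
    have "x = int_comb \<omega> (map (\<lambda>j. \<lfloor>q j\<rfloor>) [0..<d])"
      unfolding int_comb_eq_rat_comb q rat_comb_def
    proof (intro sum.cong refl)
      fix j assume "j \<in> {..<length \<omega>}"
      hence j: "j < d" using len by simp
      obtain n where "q j = of_int n" using integral[of q j] j x q by (auto elim: Ints_cases)
      thus "\<omega> ! j * of_rat (q j) = \<omega> ! j * of_rat (of_int (map (\<lambda>j. \<lfloor>q j\<rfloor>) [0..<d] ! j))"
        using j by simp
    qed
    thus "x \<in> int_comb \<omega> ` {c. length c = length \<omega>}" using len by auto
  qed
  thus ?thesis using that len D int\<omega> by blast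
qed

text \<open>
  An integral basis expresses every integral tuple by an integer matrix, so its determinant
  divides, and in absolute value does not exceed, every nonzero determinant of an integral tuple.
  Applied to
  two integral bases in both directions, this shows that the field discriminant is well defined.
\<close>

lemma field_disc_minimal:
  shows "0 < sqrt \<bar>field_disc \<sigma>\<bar>"
    and "length g = d \<Longrightarrow> set g \<subseteq> ring_of_integers \<Longrightarrow> D g \<noteq> 0 \<Longrightarrow> sqrt \<bar>field_disc \<sigma>\<bar> \<le> \<bar>D g\<bar>"
proof -
  obtain \<omega> where \<omega>: "length \<omega> = d" "integral_basis \<omega>" "D \<omega> \<noteq> 0" "set \<omega> \<subseteq> ring_of_integers"
    by (rule integral_basis_exists)
  have min: "\<bar>D b\<bar> \<le> \<bar>D g\<bar>" if b: "integral_basis b" "length b = d"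
    and g: "length g = d" "set g \<subseteq> ring_of_integers" "D g \<noteq> 0" for b g
  proof -
    obtain z :: int where z: "D g = D b * of_int z"
      using emb_det_integral_basis_multiple[OF b g(1,2)] by blast
    hence "1 \<le> \<bar>z\<bar>" using g(3) by auto
    hence "1 \<le> \<bar>of_int z :: real\<bar>" by linarith
    thus ?thesis unfolding z abs_mult using mult_left_mono[of 1 _ "\<bar>D b\<bar>"] by simp
  qed
  have int: "set b \<subseteq> ring_of_integers" if "integral_basis b" for b :: "'k list"
  proof
    fix x assume "x \<in> set b"
    then obtain i where i: "i < length b" "x = b ! i" by (auto simp: in_set_conv_nth)
    define c where "c = map (\<lambda>j. if j = i then 1 else 0 :: int) [0..<length b]"
    have "int_comb b c = (\<Sum>j<length b. if j = i then b ! j else 0)"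
      unfolding int_comb_def c_def by (intro sum.cong) auto
    hence "x = int_comb b c" using i by simp
    thus "x \<in> ring_of_integers"
      using that unfolding integral_basis_def bij_betw_def by (auto simp: c_def)
  qed
  have "field_disc \<sigma> = disc \<sigma> \<omega>"
    unfolding field_disc_def
  proof (rule the_equality)
    fix \<Delta> assume "\<exists>\<omega>'. length \<omega>' = d \<and> integral_basis \<omega>' \<and> \<Delta> = disc \<sigma> \<omega>'"
    then obtain b where b: "length b = d" "integral_basis b" "\<Delta> = disc \<sigma> b" by blast
    have "D b \<noteq> 0" using emb_det_integral_basis_multiple[OF b(2,1) \<omega>(1,4)] \<omega>(3) by auto
    hence "\<bar>D b\<bar> = \<bar>D \<omega>\<bar>"
      using min[OF b(2,1) \<omega>(1,4,3)] min[OF \<omega>(2,1) b(1) int[OF b(2)]] by simp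
    thus "\<Delta> = disc \<sigma> \<omega>" unfolding b(3) disc_def emb_det_def[symmetric] by (metis power2_abs)
  qed (use \<omega> in blast)
  hence eq: "sqrt \<bar>field_disc \<sigma>\<bar> = \<bar>D \<omega>\<bar>" by (simp add: sqrt_disc)
  show "0 < sqrt \<bar>field_disc \<sigma>\<bar>" unfolding eq using \<omega>(3) by simp
  show "length g = d \<Longrightarrow> set g \<subseteq> ring_of_integers \<Longrightarrow> D g \<noteq> 0 \<Longrightarrow> sqrt \<bar>field_disc \<sigma>\<bar> \<le> \<bar>D g\<bar>"
    unfolding eq by (rule min[OF \<omega>(2,1)])
qed

end
end

section \<open>The upper bound\<close>

text \<open>
  Caratheodory's theorem for cones, with one weight that must not drop. A dependent support has a
  relation \<open>z\<close> with \<open>0 \<le> z a\<^sub>0\<close>. As \<open>\<tau>\<close> is positive on the support, the entries of \<open>z\<close> cannot all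
  be nonnegative. Adding the largest multiple of \<open>z\<close> that keeps all weights nonnegative removes an
  element other than \<open>a\<^sub>0\<close> from the support. All of this happens over the rationals, so that the
  resulting independent support is part of a rational basis.
\<close>

lemma conic_caratheodory:
  fixes \<tau> :: "'k::number_field \<Rightarrow> real" and y :: "'k \<Rightarrow> rat"
  assumes "field_hom \<tau>" "finite S" "\<And>a. a \<in> S \<Longrightarrow> 0 < \<tau> a" "\<And>a. a \<in> S \<Longrightarrow> 0 \<le> y a" "a\<^sub>0 \<in> S"
  shows "\<exists>T y'. T \<subseteq> S \<and> a\<^sub>0 \<in> T \<and> Q.independent T \<and> y a\<^sub>0 \<le> y' a\<^sub>0 \<and>
    (\<Sum>a\<in>T. of_rat (y' a) * a) = (\<Sum>a\<in>S. of_rat (y a) * a)"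
  using assms(2-)
proof (induction S arbitrary: y rule: finite_psubset_induct)
  case (psubset S)
  show ?case
  proof (cases "Q.independent S")
    case True
    thus ?thesis using psubset.prems(3) by blast
  next
    case False
    then obtain u v where u: "v \<in> S" "u v \<noteq> 0" "(\<Sum>a\<in>S. of_rat (u a) * a) = 0"
      using Q.dependent_finite[OF psubset.hyps] by blast
    define s :: rat where "s = (if 0 \<le> u a\<^sub>0 then 1 else -1)"
    define z where "z a = s * u a" for a
    have z0: "0 \<le> z a\<^sub>0" and zv: "z v \<noteq> 0" using u(2) by (auto simp: z_def s_def)
    have "(\<Sum>a\<in>S. of_rat (z a) * a) = of_rat s * (\<Sum>a\<in>S. of_rat (u a) * a)"
      unfolding sum_distrib_left by (intro sum.cong refl) (simp add: z_def of_rat_mult)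
    hence zsum: "(\<Sum>a\<in>S. of_rat (z a) * a) = 0" using u(3) by simp
    have "\<exists>b\<in>S. z b < 0"
    proof (rule ccontr)
      interpret field_hom \<tau> by fact
      assume "\<not> ?thesis"
      hence nonneg: "0 \<le> z a" if "a \<in> S" for a using that by force
      have "0 = \<tau> (\<Sum>a\<in>S. of_rat (z a) * a)" by (simp add: zsum)
      also have "\<dots> = (\<Sum>a\<in>S. of_rat (z a) * \<tau> a)"
        unfolding hom_sum by (intro sum.cong refl) (simp add: hom_mult field_hom_of_rat[OF assms(1)])
      also have "\<dots> > 0"
        using psubset.hyps u(1) zv nonneg psubset.prems(1)
        by (intro sum_pos2[of _ v]) (auto simp: less_le)
      finally show False by simp
    qed
    hence "finite {b \<in> S. z b < 0}" "{b \<in> S. z b < 0} \<noteq> {}" using psubset.hyps by auto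
    then obtain b where b: "b \<in> {b \<in> S. z b < 0}"
        and min: "\<And>a. a \<in> {b \<in> S. z b < 0} \<Longrightarrow> y b / - z b \<le> y a / - z a"
      using ex_is_arg_min_if_finite[of "{b \<in> S. z b < 0}" "\<lambda>a. y a / - z a"]
      unfolding is_arg_min_linorder by blast
    define t where "t = y b / - z b"
    have t: "0 \<le> t" using b psubset.prems(2)[of b] by (auto simp: t_def divide_nonneg_neg)
    define y2 where "y2 a = y a + t * z a" for a
    have nonneg: "0 \<le> y2 a" if a: "a \<in> S" for a
    proof (cases "z a < 0")
      case True
      hence "t \<le> y a / - z a" using min[of a] a by (simp add: t_def)
      moreover have "0 < - z a" using True by simp
      ultimately have "t * - z a \<le> y a" using pos_le_divide_eq by blast
      thus ?thesis by (simp add: y2_def)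
    qed (use t psubset.prems(2)[OF a] in \<open>simp add: y2_def\<close>)
    have y2b: "y2 b = 0" using b by (simp add: y2_def t_def)
    have sum: "(\<Sum>a\<in>S - {b}. of_rat (y2 a) * a) = (\<Sum>a\<in>S. of_rat (y a) * a)"
    proof -
      have "(\<Sum>a\<in>S - {b}. of_rat (y2 a) * a) = (\<Sum>a\<in>S. of_rat (y2 a) * a)"
        using y2b psubset.hyps by (intro sum.mono_neutral_left) auto
      also have "\<dots> = (\<Sum>a\<in>S. of_rat (y a) * a) + of_rat t * (\<Sum>a\<in>S. of_rat (z a) * a)"
        unfolding sum_distrib_left sum.distrib[symmetric]
        by (intro sum.cong refl) (simp add: y2_def of_rat_add of_rat_mult algebra_simps)
      finally show ?thesis using zsum by simp
    qed
    have "a\<^sub>0 \<in> S - {b}" using b z0 psubset.prems(3) by auto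
    then obtain T y' where T: "T \<subseteq> S - {b}" "a\<^sub>0 \<in> T" "Q.independent T" "y2 a\<^sub>0 \<le> y' a\<^sub>0"
        "(\<Sum>a\<in>T. of_rat (y' a) * a) = (\<Sum>a\<in>S. of_rat (y a) * a)"
      using psubset.IH[of "S - {b}" y2] b psubset.prems(1) nonneg sum by auto
    moreover have "y a\<^sub>0 \<le> y2 a\<^sub>0" using t z0 by (simp add: y2_def)
    ultimately show ?thesis by (meson Diff_subset order_trans)
  qed
qed

lemma nths_append_last:
  assumes "J \<subseteq> {..<length xs}"
  shows "nths (xs @ [x]) (insert (length xs) J) = nths xs J @ [x]"
proof -
  have "nths xs (insert (length xs) J) = nths xs J"
    unfolding nths_def by (intro arg_cong[of _ _ "map fst"] filter_cong) (auto dest!: set_zip_rightD)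
  thus ?thesis by (simp add: nths_append)
qed

context full_embeddings
begin

text \<open>
  Move the representation \<open>x\<close> to one with independent support without lowering the weight of
  \<open>\<alpha> ! j\<close>, and extend the support to a rational basis \<open>B\<close> among the entries of \<open>\<alpha>\<close>. By Cramer's rule
  the new weight of \<open>\<alpha> ! j\<close> is the determinant of \<open>B\<close> with \<open>\<beta>\<close> in place of \<open>\<alpha> ! j\<close>, divided by the
  determinant of \<open>B\<close>. The former is one of the minors in the maximum, and the latter is at least
  the square root of the field discriminant.
\<close>

lemma coordinate_le_max_minor:
  assumes gen: "ring_of_integers = int_span \<alpha>" and int: "set \<alpha> \<subseteq> ring_of_integers"
    and pos: "\<And>a \<tau>. a \<in> set \<alpha> \<Longrightarrow> \<tau> \<in> set \<sigma> \<Longrightarrow> 0 < \<tau> a"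
    and x: "x \<in> nonneg_tuples (length \<alpha>)" and \<beta>: "int_comb \<alpha> x = \<beta>" and j: "j < length \<alpha>"
  shows "of_int (x ! j) \<le> max_minor \<sigma> \<alpha> \<beta>"
proof -
  define n where "n = length \<alpha>"
  (* Equal entries of \<alpha> are merged, their weights added. *)
  define y :: "'k \<Rightarrow> rat" where "y a = of_int (\<Sum>i\<in>{i \<in> {..<n}. \<alpha> ! i = a}. x ! i)" for a
  have xpos: "0 \<le> x ! i" if "i < n" for i using x that by (auto simp: nonneg_tuples_def n_def)
  have ysum: "(\<Sum>a\<in>set \<alpha>. of_rat (y a) * a) = \<beta>"
  proof -
    have "(\<Sum>a\<in>set \<alpha>. of_rat (y a) * a)
        = (\<Sum>a\<in>set \<alpha>. \<Sum>i\<in>{i \<in> {..<n}. \<alpha> ! i = a}. \<alpha> ! i * of_int (x ! i))"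
      by (intro sum.cong refl) (simp add: y_def of_rat_sum sum_distrib_left mult.commute)
    also have "\<dots> = (\<Sum>i<n. \<alpha> ! i * of_int (x ! i))"
      by (intro sum.group) (auto simp: n_def)
    finally show ?thesis using \<beta> by (simp add: int_comb_def n_def)
  qed
  have ypos: "0 \<le> y a" for a unfolding y_def using xpos by (auto intro!: sum_nonneg)
  have yj: "of_int (x ! j) \<le> y (\<alpha> ! j)"
    unfolding y_def of_int_le_iff using j xpos by (intro member_le_sum) (auto simp: n_def)
  have d: "0 < d" using length field_degree_pos[where 'k = 'k] by simp
  obtain T y' where T: "T \<subseteq> set \<alpha>" "\<alpha> ! j \<in> T" "Q.independent T" "y (\<alpha> ! j) \<le> y' (\<alpha> ! j)"
      "(\<Sum>a\<in>T. of_rat (y' a) * a) = \<beta>"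
    using conic_caratheodory[OF hom_nth[OF d], of "set \<alpha>" y "\<alpha> ! j"] pos ypos j d ysum by auto
  obtain B where B: "T \<subseteq> B" "B \<subseteq> set \<alpha>" "Q.independent B" "set \<alpha> \<subseteq> Q.span B"
    by (rule Q.maximal_independent_subset_extend[OF T(1,3)])
  have span: "Q.span B = UNIV"
    using Q.span_mono[OF B(4)] rat_span_eq_UNIV_if_generates_integers[OF gen] Q.span_span by blast
  have cardB: "card B = d" using card_rat_basis[OF B(3) span] length by simp
  have finB: "finite B" using B(2) finite_subset by blast
  define r where "r b = (SOME i. i < n \<and> \<alpha> ! i = b)" for b
  have r: "r b < n \<and> \<alpha> ! r b = b" if "b \<in> B" for b
  proof -
    have "\<exists>i. i < n \<and> \<alpha> ! i = b" using B(2) that by (auto simp: in_set_conv_nth n_def)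
    thus ?thesis unfolding r_def by (rule someI_ex)
  qed
  define J where "J = r ` (B - {\<alpha> ! j})"
  have J: "J \<subseteq> {..<n}" using r by (auto simp: J_def)
  have "inj_on r (B - {\<alpha> ! j})" by (rule inj_on_inverseI[of _ "\<lambda>i. \<alpha> ! i"]) (use r in auto)
  hence cardJ: "card J = d - 1"
    unfolding J_def using cardB T(2) B(1) finB by (simp add: card_image subset_iff)
  define g where "g = nths \<alpha> J"
  have leng: "length g = d - 1"
  proof -
    have "{i. i < length \<alpha> \<and> i \<in> J} = J" using J by (auto simp: n_def)
    thus ?thesis by (simp add: g_def length_nths cardJ)
  qed
  have setg: "set g = B - {\<alpha> ! j}"
  proof -
    have "set g = (\<lambda>i. \<alpha> ! i) ` J" using J by (auto simp: g_def set_nths n_def)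
    also have "\<dots> = B - {\<alpha> ! j}" unfolding J_def image_image using r by force
    finally show ?thesis .
  qed
  (* The basis is listed with \<alpha> ! j last, the place where \<beta>, the last entry of \<alpha> @ [\<beta>], ends up. *)
  define a where "a = g @ [\<alpha> ! j]"
  have lena: "length a = d" using leng d by (simp add: a_def)
  have seta: "set a = B" using setg T(2) B(1) by (auto simp: a_def)
  have dista: "distinct a" using lena seta cardB by (intro card_distinct) simp
  have last: "a ! (d - 1) = \<alpha> ! j" using leng by (simp add: a_def nth_append)
  define c where "c b = (if b \<in> T then y' b else 0)" for b
  have "rat_comb a (\<lambda>i. c (a ! i)) = (\<Sum>b\<in>B. of_rat (c b) * b)"
    using rat_comb_eq_sum_set[OF dista, of c] seta by simp
  also have "\<dots> = (\<Sum>a\<in>T. of_rat (y' a) * a)"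
    using B(1) finB by (intro sum.mono_neutral_cong_right) (auto simp: c_def)
  finally have comb: "rat_comb a (\<lambda>i. c (a ! i)) = \<beta>" using T(5) by simp
  have "list_update a (d - 1) \<beta> = g @ [\<beta>]"
    using leng by (simp add: a_def list_update_append)
  hence Dg: "D (g @ [\<beta>]) = of_rat (y' (\<alpha> ! j)) * D a"
    using emb_det_replace[OF lena, of "d - 1" "\<lambda>i. c (a ! i)"] comb d last T(2) by (simp add: c_def)
  have Da: "sqrt \<bar>field_disc \<sigma>\<bar> \<le> \<bar>D a\<bar>"
    using field_disc_minimal(2)[OF gen int lena] seta B(2) int emb_det_basis_nonzero[OF lena] span by auto
  have xy: "of_int (x ! j) \<le> (of_rat (y' (\<alpha> ! j)) :: real)"
  proof -
    have "of_int (x ! j) \<le> y' (\<alpha> ! j)" using yj T(4) by simp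
    hence "of_rat (of_int (x ! j)) \<le> (of_rat (y' (\<alpha> ! j)) :: real)" by (simp only: of_rat_less_eq)
    thus ?thesis by simp
  qed
  have x0: "0 \<le> (of_int (x ! j) :: real)" using xpos j by (simp add: n_def)
  have "of_int (x ! j) * sqrt \<bar>field_disc \<sigma>\<bar> \<le> of_rat (y' (\<alpha> ! j)) * \<bar>D a\<bar>"
    using xy order_trans[OF x0 xy] Da by (intro mult_mono) simp_all
  also have "\<dots> = \<bar>D (g @ [\<beta>])\<bar>" unfolding Dg abs_mult abs_of_nonneg[OF order_trans[OF x0 xy]] ..
  also have "\<dots> = sqrt \<bar>disc \<sigma> (nths (\<alpha> @ [\<beta>]) (insert n J))\<bar>"
    using nths_append_last[of J \<alpha> \<beta>] J by (simp add: sqrt_disc g_def n_def)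
  also have "\<dots> \<le> Max ((\<lambda>I. sqrt \<bar>disc \<sigma> (nths (\<alpha> @ [\<beta>]) I)\<bar>) `
      {I. I \<subseteq> {..<length \<alpha> + 1} \<and> card I = d})"
  proof (rule Max_ge)
    have "n \<notin> J" "finite J" using J finite_subset by auto
    hence "card (insert n J) = d" using cardJ d by simp
    thus "sqrt \<bar>disc \<sigma> (nths (\<alpha> @ [\<beta>]) (insert n J))\<bar> \<in> (\<lambda>I. sqrt \<bar>disc \<sigma> (nths (\<alpha> @ [\<beta>]) I)\<bar>) `
      {I. I \<subseteq> {..<length \<alpha> + 1} \<and> card I = d}"
      using J by (intro imageI) (auto simp: n_def)
  qed simp
  finally show ?thesis
    unfolding max_minor_def using field_disc_minimal(1)[OF gen int] by (simp add: field_simps)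
qed

end

section \<open>Approximation by field elements\<close>

context full_embeddings
begin

text \<open>
  The matrix \<open>B\<close> inverts the embedding matrix of a rational basis on both sides: one side solves
  for an element with given values at the embeddings, the other recovers coordinates from values.
\<close>

lemma emb_matrix_inverse:
  obtains a B where "length a = d" "D a \<noteq> 0"
    "\<And>j l. j < d \<Longrightarrow> l < d \<Longrightarrow> (\<Sum>k<d. (\<sigma> ! j) (a ! k) * B k l) = (if j = l then 1 else 0)"
    "\<And>k i. k < d \<Longrightarrow> i < d \<Longrightarrow> (\<Sum>j<d. B k j * (\<sigma> ! j) (a ! i)) = (if k = i then 1 else 0)"
proof -
  obtain a :: "'k list" where a: "length a = field_degree TYPE('k)" "Q.span (set a) = UNIV"
    by (rule rat_basis_list[OF Q.span_UNIV])
  have lena: "length a = d" using a(1) length by simp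
  have Da: "D a \<noteq> 0" by (rule emb_det_basis_nonzero[OF lena a(2)])
  let ?A = "mat d d (\<lambda>(j, k). (\<sigma> ! j) (a ! k))"
  have A: "?A \<in> carrier_mat d d" by simp
  define B where "B k l = vec_index (col (adj_mat ?A) l) k / D a" for k l
  have adjc: "adj_mat ?A \<in> carrier_mat d d" by (rule adj_mat(1)[OF A])
  have B: "B k l * D a = index_mat (adj_mat ?A) (k, l)" if "k < d" "l < d" for k l
    using Da adjc that by (simp add: B_def)
  have 1: "(\<Sum>k<d. (\<sigma> ! j) (a ! k) * B k l) = (if j = l then 1 else 0)" if "j < d" "l < d" for j l
  proof -
    have "(\<Sum>k<d. (\<sigma> ! j) (a ! k) * B k l) * D a = index_mat (?A * adj_mat ?A) (j, l)"
      using that adjc by (simp add: scalar_prod_def atLeast0LessThan B[symmetric] sum_distrib_right mult.assoc)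
    also have "\<dots> = (if j = l then 1 else 0) * D a"
      unfolding adj_mat(2)[OF A] emb_det_def using that by simp
    finally have "(\<Sum>k<d. (\<sigma> ! j) (a ! k) * B k l) * D a = (if j = l then 1 else 0) * D a" .
    thus ?thesis using Da by simp
  qed
  have 2: "(\<Sum>j<d. B k j * (\<sigma> ! j) (a ! i)) = (if k = i then 1 else 0)" if "k < d" "i < d" for k i
  proof -
    have "(\<Sum>j<d. B k j * (\<sigma> ! j) (a ! i)) * D a = (\<Sum>j<d. (B k j * D a) * (\<sigma> ! j) (a ! i))"
      unfolding sum_distrib_right by (intro sum.cong refl) (simp only: mult_ac)
    also have "\<dots> = index_mat (adj_mat ?A * ?A) (k, i)"
      using that adjc by (simp add: scalar_prod_def atLeast0LessThan B)
    also have "\<dots> = (if k = i then 1 else 0) * D a"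
      unfolding adj_mat(3)[OF A] emb_det_def using that by simp
    finally have "(\<Sum>j<d. B k j * (\<sigma> ! j) (a ! i)) * D a = (if k = i then 1 else 0) * D a" .
    thus ?thesis using Da by simp
  qed
  show ?thesis by (rule that[OF lena Da 1 2])
qed

text \<open>
  The system \<open>(\<sigma> ! j) x = s j\<close> has a real solution in coordinates with respect to a rational
  basis; rational coordinates close to these give the required element.
\<close>

lemma weak_approximation:
  assumes "0 < \<epsilon>"
  obtains x where "\<And>j. j < d \<Longrightarrow> \<bar>(\<sigma> ! j) x - s j\<bar> < \<epsilon>"
proof -
  obtain a B where a: "length a = d" and
    B: "\<And>j l. j < d \<Longrightarrow> l < d \<Longrightarrow> (\<Sum>k<d. (\<sigma> ! j) (a ! k) * B k l) = (if j = l then 1 else 0)"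
    by (rule emb_matrix_inverse) blast
  define q where "q k = (\<Sum>l<d. B k l * s l)" for k
  have q: "(\<Sum>k<d. (\<sigma> ! j) (a ! k) * q k) = s j" if j: "j < d" for j
  proof -
    have "(\<Sum>k<d. (\<sigma> ! j) (a ! k) * q k) = (\<Sum>k<d. \<Sum>l<d. (\<sigma> ! j) (a ! k) * B k l * s l)"
      by (simp add: q_def sum_distrib_left mult.assoc)
    also have "\<dots> = (\<Sum>l<d. (\<Sum>k<d. (\<sigma> ! j) (a ! k) * B k l) * s l)"
      by (subst sum.swap) (simp add: sum_distrib_right)
    also have "\<dots> = (\<Sum>l<d. if j = l then s l else 0)"
      by (intro sum.cong) (auto simp: B j)
    finally show ?thesis using j by simp
  qed
  (* The summand 1 keeps M positive and gives the strict inequality at the end. *)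
  define M where "M = (\<Sum>j<d. \<Sum>k<d. \<bar>(\<sigma> ! j) (a ! k)\<bar>) + 1"
  have M: "0 < M" unfolding M_def by (intro add_nonneg_pos sum_nonneg) auto
  have "\<exists>r :: rat. \<bar>of_rat r - q k\<bar> < \<epsilon> / M" for k
  proof -
    obtain r :: rat where "q k < of_rat r" "of_rat r < q k + \<epsilon> / M"
      using of_rat_dense[of "q k" "q k + \<epsilon> / M"] assms M by auto
    thus ?thesis by (intro exI[of _ r]) auto
  qed
  then obtain r :: "nat \<Rightarrow> rat" where r: "\<bar>of_rat (r k) - q k\<bar> < \<epsilon> / M" for k by metis
  have "\<bar>(\<sigma> ! j) (rat_comb a r) - s j\<bar> < \<epsilon>" if j: "j < d" for j
  proof -
    have "(\<sigma> ! j) (rat_comb a r) - s j = (\<Sum>k<d. (\<sigma> ! j) (a ! k) * (of_rat (r k) - q k))"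
      unfolding q[OF j, symmetric] field_hom_rat_comb[OF hom_nth[OF j]] a sum_subtractf[symmetric]
      by (intro sum.cong refl) (simp add: algebra_simps)
    hence "\<bar>(\<sigma> ! j) (rat_comb a r) - s j\<bar> \<le> (\<Sum>k<d. \<bar>(\<sigma> ! j) (a ! k)\<bar> * \<bar>of_rat (r k) - q k\<bar>)"
      by (metis (no_types, lifting) abs_mult sum.cong sum_abs)
    also have "\<dots> \<le> (\<Sum>k<d. \<bar>(\<sigma> ! j) (a ! k)\<bar> * (\<epsilon> / M))"
      using r by (intro sum_mono mult_left_mono) (auto intro: less_imp_le)
    also have "\<dots> = (\<Sum>k<d. \<bar>(\<sigma> ! j) (a ! k)\<bar>) * (\<epsilon> / M)"
      by (rule sum_distrib_right[symmetric])
    also have "\<dots> \<le> (M - 1) * (\<epsilon> / M)"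
    proof (rule mult_right_mono)
      show "(\<Sum>k<d. \<bar>(\<sigma> ! j) (a ! k)\<bar>) \<le> M - 1"
        unfolding M_def add_diff_cancel_right'
        using member_le_sum[of j "{..<d}" "\<lambda>j. \<Sum>k<d. \<bar>(\<sigma> ! j) (a ! k)\<bar>"] j
        by (auto intro: sum_nonneg)
    qed (use assms M in simp)
    also have "\<dots> < M * (\<epsilon> / M)" using assms M by (intro mult_strict_right_mono) auto
    finally show ?thesis using M by simp
  qed
  thus ?thesis by (rule that)
qed

end

section \<open>Absolute values on a number field\<close>

lemma absolute_valueD:
  assumes "absolute_value v"
  shows "0 \<le> v x" "v x = 0 \<longleftrightarrow> x = 0" "v (x * y) = v x * v y" "v (x + y) \<le> v x + v y"
  using assms unfolding absolute_value_def by blast+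

lemma absolute_value_1: "absolute_value v \<Longrightarrow> v 1 = 1"
  using absolute_valueD(2)[of v 1] absolute_valueD(3)[of v 1 1] by simp

lemma absolute_value_minus: "absolute_value v \<Longrightarrow> v (- x) = v x"
proof -
  assume v: "absolute_value v"
  have "v (-1) * v (-1) = 1" using absolute_valueD(3)[OF v, of "-1" "-1"] absolute_value_1[OF v] by simp
  hence "v (-1) = 1" using absolute_valueD(1)[OF v, of "-1"]
    by (metis abs_of_nonneg real_sqrt_abs2 real_sqrt_one)
  thus ?thesis using absolute_valueD(3)[OF v, of "-1" x] by simp
qed

lemma absolute_value_power: "absolute_value v \<Longrightarrow> v (x ^ n) = v x ^ n"
  by (induction n) (simp_all add: absolute_value_1 absolute_valueD)

lemma absolute_value_sum:
  assumes "absolute_value v"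
  shows "v (\<Sum>i\<in>I. f i) \<le> (\<Sum>i\<in>I. v (f i))"
proof (induction I rule: infinite_finite_induct)
  case (insert i I)
  thus ?case using absolute_valueD(4)[OF assms, of "f i" "sum f I"] by simp
qed (use absolute_valueD(2)[OF assms, of 0] in auto)

lemma absolute_value_diff_le: "absolute_value v \<Longrightarrow> v x \<le> v y + v (x - y)"
  using absolute_valueD(4)[of v y "x - y"] by simp

lemma padic_abs_of_int_le_1:
  assumes "Factorial_Ring.prime (p::nat)"
  shows "padic_abs p (of_int n) \<le> 1"
proof -
  have "real p powi (- int m) \<le> 1" for m
    using prime_ge_1_nat[OF assms] by (simp add: power_int_minus inverse_le_1_iff)
  moreover have "quotient_of (of_int n) = (n, 1)" by simp
  ultimately show ?thesis by (simp add: padic_abs_def)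
qed

text \<open>
  Division by the monic polynomial of \<open>a\<close>: every power of \<open>a\<close> is an integer combination of the
  powers below the degree of that polynomial.
\<close>

lemma algebraic_int_power_reduction:
  assumes "algebraic_int (a :: 'k::number_field)"
  shows "\<exists>m. \<forall>N. \<exists>c::nat \<Rightarrow> int. a ^ N = (\<Sum>i<m. of_int (c i) * a ^ i)"
proof -
  obtain p where p: "poly (map_poly of_int p) a = 0" "lead_coeff p = 1"
    using assms unfolding algebraic_int_altdef_ipoly by blast
  define m where "m = degree p"
  have "(\<Sum>i\<le>m. of_int (coeff p i) * a ^ i) = 0"
    using p(1) by (simp add: poly_altdef m_def)
  hence top: "a ^ m = (\<Sum>i<m. of_int (- coeff p i) * a ^ i)"
    using p(2) by (simp add: lessThan_Suc_atMost[symmetric] m_def sum_negf eq_neg_iff_add_eq_0 add.commute)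
  have "\<exists>c::nat \<Rightarrow> int. a ^ N = (\<Sum>i<m. of_int (c i) * a ^ i)" for N
  proof (induction N)
    case 0
    show ?case
    proof (cases m)
      case 0
      thus ?thesis using top by simp
    next
      case (Suc k)
      have "a ^ 0 = (\<Sum>i<m. of_int (if i = 0 then 1 else 0) * a ^ i)"
        unfolding Suc sum.lessThan_Suc_shift by simp
      thus ?thesis by (intro exI[of _ "\<lambda>i. if i = 0 then 1 else 0"])
    qed
  next
    case (Suc N)
    then obtain c where c: "a ^ N = (\<Sum>i<m. of_int (c i) * a ^ i)" by blast
    show ?case
    proof (cases m)
      case 0
      thus ?thesis using c by simp
    next
      case (Suc k)
      (* Multiplying by a shifts the coefficients up by one; the overflow c k * a ^ m is replaced
         by means of the polynomial. *)
      define e where "e i = (if i = 0 then 0 else c (i - 1)) + c k * - coeff p i" for i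
      have "a ^ Suc N = (\<Sum>i<m. of_int (c i) * a ^ Suc i)"
        by (simp add: c sum_distrib_left mult_ac)
      also have "\<dots> = (\<Sum>i<k. of_int (c i) * a ^ Suc i) + of_int (c k) * a ^ m"
        by (simp add: Suc)
      also have "(\<Sum>i<k. of_int (c i) * a ^ Suc i) = (\<Sum>i<m. of_int (if i = 0 then 0 else c (i - 1)) * a ^ i)"
        unfolding Suc sum.lessThan_Suc_shift by simp
      also have "of_int (c k) * a ^ m = (\<Sum>i<m. of_int (c k * - coeff p i) * a ^ i)"
        by (subst top) (simp add: sum_distrib_left mult.assoc)
      also have "(\<Sum>i<m. of_int (if i = 0 then 0 else c (i - 1)) * a ^ i) + \<dots> = (\<Sum>i<m. of_int (e i) * a ^ i)"
        unfolding sum.distrib[symmetric] e_def by (intro sum.cong refl) (simp add: algebra_simps)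
      finally show ?thesis by blast
    qed
  qed
  thus ?thesis by blast
qed

text \<open>
  All powers of an algebraic integer are combinations of the same finitely many powers, with
  coefficients of absolute value at most 1. So the powers of \<open>v a\<close> are bounded.
\<close>

lemma absolute_value_integer_le_1:
  assumes v: "absolute_value v" and int: "\<And>n. v (of_int n) \<le> 1" and a: "algebraic_int a"
  shows "v a \<le> 1"
proof (rule ccontr)
  assume "\<not> v a \<le> 1"
  obtain m where m: "\<And>N. \<exists>c::nat \<Rightarrow> int. a ^ N = (\<Sum>i<m. of_int (c i) * a ^ i)"
    using algebraic_int_power_reduction[OF a] by blast
  obtain N where N: "(\<Sum>i<m. v a ^ i) < v a ^ N"
    using real_arch_pow[of "v a"] \<open>\<not> v a \<le> 1\<close> by (meson not_le)
  obtain c :: "nat \<Rightarrow> int" where c: "a ^ N = (\<Sum>i<m. of_int (c i) * a ^ i)" using m by blast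
  have "v a ^ N = v (\<Sum>i<m. of_int (c i) * a ^ i)"
    by (simp add: absolute_value_power[OF v, symmetric] c)
  also have "\<dots> \<le> (\<Sum>i<m. v (of_int (c i) * a ^ i))" by (rule absolute_value_sum[OF v])
  also have "\<dots> \<le> (\<Sum>i<m. v a ^ i)"
    by (intro sum_mono) (simp add: absolute_valueD[OF v] absolute_value_power[OF v] int mult_left_le_one_le)
  finally show False using N by simp
qed

context full_embeddings
begin

text \<open>
  An archimedean absolute value is bounded by the maximum norm of the coordinates in a rational
  basis, and the inverse of the embedding matrix bounds these coordinates by the values of the
  embeddings.
\<close>

lemma absolute_value_dominated:
  assumes v: "absolute_value v" and rat: "\<And>q. v (of_rat q) = \<bar>of_rat q\<bar>"
  shows "\<exists>C>0. \<forall>x M. (\<forall>j<d. \<bar>(\<sigma> ! j) x\<bar> \<le> M) \<longrightarrow> v x \<le> C * M"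
proof -
  obtain a B where a: "length a = d" "D a \<noteq> 0" and
    B: "\<And>k i. k < d \<Longrightarrow> i < d \<Longrightarrow> (\<Sum>j<d. B k j * (\<sigma> ! j) (a ! i)) = (if k = i then 1 else 0)"
    by (rule emb_matrix_inverse) blast
  define C where "C = (\<Sum>k<d. v (a ! k) * (\<Sum>j<d. \<bar>B k j\<bar>)) + 1"
  have C: "0 < C" unfolding C_def
    by (intro add_nonneg_pos sum_nonneg mult_nonneg_nonneg) (auto simp: absolute_valueD[OF v])
  have "v x \<le> C * M" if M: "\<And>j. j < d \<Longrightarrow> \<bar>(\<sigma> ! j) x\<bar> \<le> M" for x M
  proof -
    have d: "0 < d" using length field_degree_pos[where 'k = 'k] by simp
    have M0: "0 \<le> M" using M[OF d] by simp
    obtain q where q: "x = rat_comb a q" using rat_comb_surj[OF a] by blast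
    have coeff: "(\<Sum>j<d. B k j * (\<sigma> ! j) x) = of_rat (q k)" if k: "k < d" for k
    proof -
      have "(\<Sum>j<d. B k j * (\<sigma> ! j) x) = (\<Sum>j<d. \<Sum>i<d. B k j * (\<sigma> ! j) (a ! i) * of_rat (q i))"
        by (simp add: q field_hom_rat_comb[OF hom_nth] a(1) sum_distrib_left mult.assoc)
      also have "\<dots> = (\<Sum>i<d. (\<Sum>j<d. B k j * (\<sigma> ! j) (a ! i)) * of_rat (q i))"
        by (subst sum.swap) (simp add: sum_distrib_right)
      also have "\<dots> = (\<Sum>i<d. if k = i then of_rat (q i) else 0)"
        by (intro sum.cong) (auto simp: B k)
      finally show ?thesis using k by simp
    qed
    have qk: "\<bar>of_rat (q k)\<bar> \<le> (\<Sum>j<d. \<bar>B k j\<bar>) * M" if k: "k < d" for k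
    proof -
      have "\<bar>\<Sum>j<d. B k j * (\<sigma> ! j) x\<bar> \<le> (\<Sum>j<d. \<bar>B k j\<bar> * \<bar>(\<sigma> ! j) x\<bar>)"
        using sum_abs[of "\<lambda>j. B k j * (\<sigma> ! j) x" "{..<d}"] by (simp add: abs_mult)
      also have "\<dots> \<le> (\<Sum>j<d. \<bar>B k j\<bar> * M)"
        using M by (intro sum_mono mult_left_mono) auto
      finally show ?thesis unfolding coeff[OF k] sum_distrib_right .
    qed
    have "v x \<le> (\<Sum>k<d. v (a ! k * of_rat (q k)))"
      using absolute_value_sum[OF v] by (simp add: q rat_comb_def a(1))
    also have "\<dots> = (\<Sum>k<d. v (a ! k) * \<bar>of_rat (q k)\<bar>)"
      by (simp add: absolute_valueD[OF v] rat)
    also have "\<dots> \<le> (\<Sum>k<d. v (a ! k) * ((\<Sum>j<d. \<bar>B k j\<bar>) * M))"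
      using qk by (intro sum_mono mult_left_mono) (auto simp: absolute_valueD[OF v])
    also have "\<dots> = (C - 1) * M"
      unfolding C_def by (simp add: sum_distrib_right mult.assoc)
    also have "\<dots> \<le> C * M" using M0 by (intro mult_right_mono) auto
    finally show ?thesis .
  qed
  thus ?thesis using C by blast
qed

text \<open>
  By the domination above, \<open>v\<close> is a continuous multiplicative seminorm on the dense image of the
  field in a product of real lines. The idempotents of this product are approximated by field
  elements \<open>e\<close>; as they sum up to 1, one of them, the \<open>j\<close>-th, stays away from zero under \<open>v\<close>.
  Multiplication by it suppresses all other coordinates. Therefore \<open>v x\<close> is small whenever
  \<open>(\<sigma> ! j) x\<close> is. Apply this to \<open>x - q\<close> with \<open>q\<close> a rational number close to \<open>(\<sigma> ! j) x\<close>, at which \<open>v\<close> is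
  known.
\<close>

lemma archimedean_absolute_value_is_embedding:
  assumes v: "absolute_value v" and rat: "\<And>q. v (of_rat q) = \<bar>of_rat q\<bar>"
  shows "\<exists>j<d. \<forall>x. v x = \<bar>(\<sigma> ! j) x\<bar>"
proof -
  obtain C where C: "0 < C" "\<And>x M. (\<And>j. j < d \<Longrightarrow> \<bar>(\<sigma> ! j) x\<bar> \<le> M) \<Longrightarrow> v x \<le> C * M"
    using absolute_value_dominated[OF v rat] by blast
  have d: "0 < d" using length field_degree_pos[where 'k = 'k] by simp
  define near where "near \<epsilon> j e \<longleftrightarrow> (\<forall>i<d. \<bar>(\<sigma> ! i) e - (if i = j then 1 else 0)\<bar> < \<epsilon>)" for \<epsilon> j e
  define h where "h = 1 / (2 * real d)"
  have h: "0 < h" using d by (simp add: h_def)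
  have ex: "\<exists>e. near \<epsilon> j e" if "0 < \<epsilon>" for \<epsilon> j
    using weak_approximation[OF that, of "\<lambda>i. if i = j then 1 else 0"] unfolding near_def by metis
  have "\<exists>j<d. \<forall>\<epsilon>>0. \<exists>e. near \<epsilon> j e \<and> h \<le> v e"
  proof (rule ccontr)
    assume "\<not> ?thesis"
    hence "\<forall>j\<in>{..<d}. \<exists>\<epsilon>>0. \<forall>e. near \<epsilon> j e \<longrightarrow> v e < h" by (auto simp: not_le)
    then obtain \<epsilon> where \<epsilon>: "\<And>j. j < d \<Longrightarrow> 0 < \<epsilon> j" "\<And>j e. j < d \<Longrightarrow> near (\<epsilon> j) j e \<Longrightarrow> v e < h"
      by (metis lessThan_iff)
    (* So small that the d approximate idempotents sum up to 1 within 1/2 under v. *)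
    define \<eta> where "\<eta> = Min (insert (1 / (2 * C * real d)) (\<epsilon> ` {..<d}))"
    have \<eta>: "0 < \<eta>" "\<eta> \<le> 1 / (2 * C * real d)" "\<And>j. j < d \<Longrightarrow> \<eta> \<le> \<epsilon> j"
      unfolding \<eta>_def using \<epsilon>(1) C(1) d by (auto intro!: Min_le)
    obtain e where e: "near \<eta> j (e j)" for j using ex[OF \<eta>(1)] by metis
    have small: "v (e j) < h" if j: "j < d" for j
      using \<epsilon>(2)[OF j, of "e j"] e[of j] \<eta>(3)[OF j] unfolding near_def by (meson less_le_trans)
    have "\<bar>(\<sigma> ! i) (1 - (\<Sum>j<d. e j))\<bar> \<le> real d * \<eta>" if i: "i < d" for i
    proof -
      interpret field_hom "\<sigma> ! i" by (rule hom_nth[OF i])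
      have "(\<sigma> ! i) (1 - (\<Sum>j<d. e j)) = (\<Sum>j<d. (if i = j then 1 else 0) - (\<sigma> ! i) (e j))"
        using i by (simp add: hom_minus hom_sum sum_subtractf)
      hence "\<bar>(\<sigma> ! i) (1 - (\<Sum>j<d. e j))\<bar> \<le> (\<Sum>j<d. \<bar>(if i = j then 1 else 0) - (\<sigma> ! i) (e j)\<bar>)"
        by simp
      also have "\<dots> \<le> (\<Sum>j<d. \<eta>)"
        using e i by (intro sum_mono) (simp add: near_def abs_minus_commute less_imp_le)
      finally show ?thesis by simp
    qed
    hence "v (1 - (\<Sum>j<d. e j)) \<le> C * (real d * \<eta>)" by (rule C(2))
    also have "\<dots> \<le> C * (real d * (1 / (2 * C * real d)))"
      using C(1) \<eta>(2) by (intro mult_left_mono) auto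
    also have "\<dots> = 1 / 2" using C(1) d by simp
    finally have "v (1 - (\<Sum>j<d. e j)) \<le> 1 / 2" .
    hence "1 \<le> v (\<Sum>j<d. e j) + 1 / 2"
      using absolute_value_diff_le[OF v, of 1 "\<Sum>j<d. e j"] absolute_value_1[OF v] by simp
    also have "v (\<Sum>j<d. e j) \<le> (\<Sum>j<d. v (e j))" by (rule absolute_value_sum[OF v])
    also have "(\<Sum>j<d. v (e j)) < (\<Sum>j<d. h)"
      using d small by (intro sum_strict_mono) auto
    also have "(\<Sum>j<d. h) = 1 / 2" using d by (simp add: h_def)
    finally show False by simp
  qed
  then obtain j where j: "j < d" and large: "\<And>\<epsilon>. 0 < \<epsilon> \<Longrightarrow> \<exists>e. near \<epsilon> j e \<and> h \<le> v e" by blast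
  interpret \<tau>: field_hom "\<sigma> ! j" by (rule hom_nth[OF j])
  have close: "v x \<le> 2 * C / h * \<delta>" if x: "\<bar>(\<sigma> ! j) x\<bar> < \<delta>" for x \<delta>
  proof -
    define M where "M = (\<Sum>i<d. \<bar>(\<sigma> ! i) x\<bar>) + 1"
    have M: "\<bar>(\<sigma> ! i) x\<bar> \<le> M" if "i < d" for i
      unfolding M_def using member_le_sum[of i "{..<d}" "\<lambda>i. \<bar>(\<sigma> ! i) x\<bar>"] that by simp
    have M0: "0 < M" unfolding M_def by (intro add_nonneg_pos sum_nonneg) auto
    have \<delta>: "0 < \<delta>" using x by simp
    (* At place j the factor e is bounded by 2; at the others it beats the size M of x. *)
    obtain e where e: "near (min 1 (\<delta> / M)) j e" "h \<le> v e" using large[of "min 1 (\<delta> / M)"] \<delta> M0 by auto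
    have "\<bar>(\<sigma> ! i) (x * e)\<bar> \<le> 2 * \<delta>" if i: "i < d" for i
    proof (cases "i = j")
      case True
      have "\<bar>(\<sigma> ! j) e - 1\<bar> < 1" using e(1) j unfolding near_def by force
      hence "\<bar>(\<sigma> ! j) e\<bar> \<le> 2" by linarith
      hence "\<bar>(\<sigma> ! j) x\<bar> * \<bar>(\<sigma> ! j) e\<bar> \<le> \<delta> * 2" using x by (intro mult_mono) auto
      thus ?thesis using True by (simp add: \<tau>.hom_mult abs_mult)
    next
      case False
      have "\<bar>(\<sigma> ! i) e\<bar> < \<delta> / M" using e(1) i False unfolding near_def by force
      hence "\<bar>(\<sigma> ! i) x\<bar> * \<bar>(\<sigma> ! i) e\<bar> \<le> M * (\<delta> / M)" using M[OF i] M0 by (intro mult_mono) auto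
      also have "\<dots> \<le> 2 * \<delta>" using M0 \<delta> by simp
      finally show ?thesis by (simp add: field_hom_mult[OF hom_nth[OF i]] abs_mult)
    qed
    hence "v (x * e) \<le> C * (2 * \<delta>)" by (rule C(2))
    moreover have "v x * h \<le> v x * v e" using e(2) by (intro mult_left_mono) (auto simp: absolute_valueD[OF v])
    ultimately have "v x * h \<le> C * (2 * \<delta>)" by (simp add: absolute_valueD[OF v])
    thus ?thesis using h by (simp add: field_simps)
  qed
  have "v x = \<bar>(\<sigma> ! j) x\<bar>" for x
  proof -
    have "\<bar>v x - \<bar>(\<sigma> ! j) x\<bar>\<bar> \<le> (2 * C / h + 1) * \<delta>" if \<delta>: "0 < \<delta>" for \<delta>
    proof -
      obtain q :: rat where "(\<sigma> ! j) x < of_rat q" "of_rat q < (\<sigma> ! j) x + \<delta>"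
        using of_rat_dense[of "(\<sigma> ! j) x" "(\<sigma> ! j) x + \<delta>"] \<delta> by auto
      hence q: "\<bar>(\<sigma> ! j) x - of_rat q\<bar> < \<delta>" by auto
      hence "\<bar>(\<sigma> ! j) (x - of_rat q)\<bar> < \<delta>"
        by (simp add: \<tau>.hom_minus field_hom_of_rat[OF hom_nth[OF j]])
      hence vq: "v (x - of_rat q) \<le> 2 * C / h * \<delta>" by (rule close)
      have "v x \<le> \<bar>of_rat q\<bar> + v (x - of_rat q)" "\<bar>of_rat q\<bar> \<le> v x + v (x - of_rat q)"
        using absolute_value_diff_le[OF v, of x "of_rat q"] absolute_value_diff_le[OF v, of "of_rat q" x]
          absolute_value_minus[OF v, of "x - of_rat q"] rat[of q] by simp_all
      hence "\<bar>v x - \<bar>(\<sigma> ! j) x\<bar>\<bar> \<le> 2 * C / h * \<delta> + \<delta>" using vq q by linarith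
      thus ?thesis by (simp add: algebra_simps)
    qed note bound = this
    define K where "K = 2 * C / h + 1"
    have K: "0 < K" unfolding K_def using C(1) h by (intro add_pos_pos) auto
    show ?thesis
    proof (rule ccontr)
      define w where "w = \<bar>v x - \<bar>(\<sigma> ! j) x\<bar>\<bar>"
      assume "v x \<noteq> \<bar>(\<sigma> ! j) x\<bar>"
      hence w: "0 < w" by (simp add: w_def)
      hence "w \<le> K * (w / (2 * K))" using bound[of "w / (2 * K)"] K by (simp add: w_def K_def)
      also have "\<dots> = w / 2" using K by simp
      finally show False using w by simp
    qed
  qed
  thus ?thesis using j by blast
qed

end

section \<open>Completion at a real place\<close>

definition real_ring :: "real ring" where
  "real_ring = \<lparr>carrier = UNIV, monoid.mult = (*), one = 1, zero = 0, add = (+)\<rparr>"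

lemma field_real_ring: "field real_ring"
proof -
  interpret cring real_ring
  proof (intro cringI abelian_groupI comm_monoidI)
    fix x
    show "\<exists>y\<in>carrier real_ring. y \<oplus>\<^bsub>real_ring\<^esub> x = \<zero>\<^bsub>real_ring\<^esub>"
      by (intro bexI[of _ "- x"]) (simp_all add: real_ring_def)
  qed (auto simp: real_ring_def algebra_simps)
  show ?thesis
  proof (rule cring_fieldI2)
    fix x assume "x \<noteq> \<zero>\<^bsub>real_ring\<^esub>"
    thus "\<exists>y\<in>carrier real_ring. x \<otimes>\<^bsub>real_ring\<^esub> y = \<one>\<^bsub>real_ring\<^esub>"
      by (intro bexI[of _ "inverse x"]) (simp_all add: real_ring_def)
  qed (simp add: real_ring_def)
qed

lemma cauchy_seqs_real:
  assumes "field_hom (\<tau> :: 'k::number_field \<Rightarrow> real)"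
  shows "f \<in> cauchy_seqs (\<lambda>x. \<bar>\<tau> x\<bar>) \<longleftrightarrow> convergent (\<lambda>m. \<tau> (f m))"
proof -
  interpret field_hom \<tau> by fact
  show ?thesis
    unfolding Cauchy_convergent_iff[symmetric] Cauchy_def
    by (simp add: cauchy_seqs_def dist_real_def hom_minus)
qed

text \<open>
  Taking limits of the images under \<open>\<tau>\<close> is a ring homomorphism from the Cauchy sequences to the
  reals. Its kernel is the null sequences. Already the rational Cauchy sequences reach every real
  number. Hence the completion is a field, isomorphic to the reals, and coincides with the
  completion of the rationals inside it, over which it has dimension 1.
\<close>

lemma local_degree_real:
  assumes "field_hom (\<tau> :: 'k::number_field \<Rightarrow> real)"
  shows "local_degree (\<lambda>x. \<bar>\<tau> x\<bar>) = 1"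
proof -
  interpret \<tau>: field_hom \<tau> by fact
  let ?v = "\<lambda>x. \<bar>\<tau> x\<bar>" and ?S = real_ring
  let ?R = "cauchy_ring ?v"
  define h where "h f = lim (\<lambda>m. \<tau> (f m))" for f
  interpret S: field ?S by (rule field_real_ring)
  note sel = real_ring_def cauchy_ring_def cauchy_seqs_real[OF assms]
  have lim: "(\<lambda>m. \<tau> (f m)) \<longlonglongrightarrow> h f" if "f \<in> carrier ?R" for f
    using that by (simp add: sel h_def convergent_LIMSEQ_iff)
  have h: "h f = l" if "(\<lambda>m. \<tau> (f m)) \<longlonglongrightarrow> l" for f l
    unfolding h_def using that by (rule limI)
  have R: "cring ?R"
  proof (intro cringI abelian_groupI comm_monoidI)
    fix f assume f: "f \<in> carrier ?R"
    hence "convergent (\<lambda>m. \<tau> (- f m))"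
      by (simp add: sel \<tau>.hom_uminus convergent_minus_iff[symmetric])
    thus "\<exists>g\<in>carrier ?R. g \<oplus>\<^bsub>?R\<^esub> f = \<zero>\<^bsub>?R\<^esub>"
      by (intro bexI[of _ "\<lambda>m. - f m"]) (simp_all add: sel)
  qed (auto simp: sel algebra_simps \<tau>.hom_add \<tau>.hom_mult intro: convergent_add convergent_mult convergent_const)
  interpret R: cring ?R by (rule R)
  have "h \<in> Ring.ring_hom ?R ?S"
  proof (rule ring_hom_memI)
    fix f g assume fg: "f \<in> carrier ?R" "g \<in> carrier ?R"
    show "h (f \<otimes>\<^bsub>?R\<^esub> g) = h f \<otimes>\<^bsub>?S\<^esub> h g"
      using tendsto_mult[OF lim[OF fg(1)] lim[OF fg(2)]] by (simp add: sel \<tau>.hom_mult h)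
    show "h (f \<oplus>\<^bsub>?R\<^esub> g) = h f \<oplus>\<^bsub>?S\<^esub> h g"
      using tendsto_add[OF lim[OF fg(1)] lim[OF fg(2)]] by (simp add: sel \<tau>.hom_add h)
  qed (simp_all add: sel h)
  hence hom: "ring_hom_ring ?R ?S h"
    by (rule ring_hom_ringI2[OF R.ring_axioms S.ring_axioms])
  have ker: "a_kernel ?R ?S h = null_seqs ?v"
  proof (intro equalityI subsetI)
    fix f assume "f \<in> a_kernel ?R ?S h"
    hence "f \<in> carrier ?R" "h f = 0" by (simp_all add: a_kernel_def' real_ring_def)
    thus "f \<in> null_seqs ?v" using lim[of f] by (simp add: null_seqs_def tendsto_rabs_zero_iff)
  next
    fix f assume "f \<in> null_seqs ?v"
    hence 0: "(\<lambda>m. \<tau> (f m)) \<longlonglongrightarrow> 0" by (simp add: null_seqs_def tendsto_rabs_zero_iff)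
    hence "f \<in> carrier ?R" by (auto simp: sel intro: convergentI)
    thus "f \<in> a_kernel ?R ?S h" using h[OF 0] by (simp add: a_kernel_def' real_ring_def)
  qed
  have rational: "\<exists>g\<in>carrier ?R. range g \<subseteq> \<rat> \<and> h g = r" for r
  proof -
    have "\<exists>q :: rat. \<bar>of_rat q - r\<bar> < inverse (real (Suc m))" for m
    proof -
      obtain q :: rat where "r < of_rat q" "of_rat q < r + inverse (real (Suc m))"
        using of_rat_dense[of r "r + inverse (real (Suc m))"] by auto
      thus ?thesis by (intro exI[of _ q]) auto
    qed
    then obtain q :: "nat \<Rightarrow> rat" where q: "\<bar>of_rat (q m) - r\<bar> < inverse (real (Suc m))" for m by metis
    have "(\<lambda>m. of_rat (q m) - r) \<longlonglongrightarrow> 0"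
      by (rule Lim_null_comparison[OF always_eventually LIMSEQ_inverse_real_of_nat])
         (use less_imp_le[OF q] in simp)
    hence "(\<lambda>m. \<tau> (of_rat (q m))) \<longlonglongrightarrow> r"
      by (simp add: field_hom_of_rat[OF assms] LIM_zero_iff)
    thus ?thesis
      by (intro bexI[of _ "\<lambda>m. of_rat (q m)"]) (auto simp: sel h intro: convergentI)
  qed
  have surj: "h ` carrier ?R = carrier ?S"
    using rational by (auto simp: real_ring_def image_iff) metis
  have comp: "completion ?v = ?R Quot a_kernel ?R ?S h" by (simp add: completion_def ker)
  interpret C: ring "completion ?v"
    unfolding comp by (rule ideal.quotient_is_ring[OF ring_hom_ring.kernel_is_ideal[OF hom]])
  have "field (completion ?v)"
  proof -
    obtain \<phi> where \<phi>: "\<phi> \<in> ring_iso ?S (completion ?v)"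
      using ring_iso_set_sym[OF C.ring_axioms ring_hom_ring.FactRing_iso_set[OF hom surj, folded comp]] by blast
    have "\<phi> \<zero>\<^bsub>?S\<^esub> = \<zero>\<^bsub>completion ?v\<^esub>"
      using ring_hom_zero[OF _ S.ring_axioms C.ring_axioms] \<phi> by (auto simp: ring_iso_def)
    thus ?thesis using S.ring_iso_imp_img_field[OF \<phi>] by simp
  qed
  then interpret C: field "completion ?v" .
  have carrier: "carrier ?R = cauchy_seqs ?v" by (simp add: cauchy_ring_def)
  have "rat_completion ?v = carrier (completion ?v)"
  proof (intro equalityI subsetI)
    fix X assume "X \<in> rat_completion ?v"
    thus "X \<in> carrier (completion ?v)"
      by (auto simp: rat_completion_def completion_def FactRing_def A_RCOSETS_def' carrier)
  next
    fix X assume X: "X \<in> carrier (completion ?v)"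
    then obtain f where f: "f \<in> carrier ?R" "X = a_kernel ?R ?S h +>\<^bsub>?R\<^esub> f"
      by (auto simp: comp FactRing_def A_RCOSETS_def')
    obtain g where g: "g \<in> carrier ?R" "range g \<subseteq> \<rat>" "h g = h f" using rational by blast
    have "X = a_kernel ?R ?S h +>\<^bsub>?R\<^esub> g"
      unfolding f(2)
      by (rule ring_hom_ring.the_elem_inj[OF hom]) (use f g in \<open>auto simp: FactRing_def A_RCOSETS_def' ring_hom_ring.the_elem_simp[OF hom]\<close>)
    thus "X \<in> rat_completion ?v"
      using g by (auto simp: rat_completion_def ker carrier)
  qed
  moreover have "C.dimension 1 (carrier (completion ?v)) (carrier (completion ?v))"
    by (rule C.dimension_one[OF C.carrier_is_subfield])
  ultimately show ?thesis
    unfolding local_degree_def using C.dimI[OF C.carrier_is_subfield] by (simp add: over_def)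
qed

section \<open>Heights and the lower bound\<close>

context full_embeddings
begin

definition archimedean_places :: "('k \<Rightarrow> real) set" where
  "archimedean_places = {v \<in> places. \<forall>q. v (of_rat q) = \<bar>of_rat q\<bar>}"

text \<open>
  This bounds the number of archimedean places by the degree, and it makes their local degrees 1.
\<close>

lemma archimedean_places_subset: "archimedean_places \<subseteq> (\<lambda>\<tau> x. \<bar>\<tau> x\<bar>) ` set \<sigma>"
proof
  fix v assume "v \<in> archimedean_places"
  then obtain j where "j < d" "\<forall>x. v x = \<bar>(\<sigma> ! j) x\<bar>"
    using archimedean_absolute_value_is_embedding[of v] by (auto simp: archimedean_places_def places_def)
  thus "v \<in> (\<lambda>\<tau> x. \<bar>\<tau> x\<bar>) ` set \<sigma>" by (intro image_eqI[of _ _ "\<sigma> ! j"]) auto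
qed

lemma finite_archimedean_places: "finite archimedean_places"
  by (rule finite_subset[OF archimedean_places_subset]) simp

lemma card_archimedean_places: "card archimedean_places \<le> d"
  using surj_card_le[OF _ archimedean_places_subset] card_length[of \<sigma>] by force

lemma local_height_archimedean:
  assumes "v \<in> archimedean_places"
  shows "local_height \<gamma> v = Max (insert 1 (v ` set \<gamma>))"
proof -
  obtain \<tau> where "\<tau> \<in> set \<sigma>" "v = (\<lambda>x. \<bar>\<tau> x\<bar>)" using archimedean_places_subset assms by blast
  hence "place_abs v = v" using local_degree_real[OF hom] by (auto simp: place_abs_def)
  thus ?thesis by (simp add: local_height_def)
qed

lemma local_height_integers_nonarchimedean:
  assumes "set \<gamma> \<subseteq> ring_of_integers" "v \<in> places" "v \<notin> archimedean_places"
  shows "local_height \<gamma> v = 1"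
proof -
  obtain p :: nat where v: "absolute_value v" and p: "Factorial_Ring.prime p" "\<And>q. v (of_rat q) = padic_abs p q"
    using assms(2,3) by (auto simp: places_def archimedean_places_def)
  have "v (of_int n) \<le> 1" for n
    using padic_abs_of_int_le_1[OF p(1), of n] p(2)[of "of_int n"] by simp
  hence "v a \<le> 1" if "a \<in> set \<gamma>" for a
    using absolute_value_integer_le_1[OF v] assms(1) that by (auto simp: ring_of_integers_def)
  hence "place_abs v a \<le> 1" if "a \<in> set \<gamma>" for a
    using that absolute_valueD(1)[OF v] by (simp add: place_abs_def power_le_one)
  thus ?thesis unfolding local_height_def by (intro Max_eqI) auto
qed

text \<open>
  Integers have absolute value at most 1 at all \<open>p\<close>-adic places, so only the archimedean places
  contribute to the height.
\<close>

lemma height_integers: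
  assumes "set \<gamma> \<subseteq> ring_of_integers"
  shows "height \<gamma> = (\<Prod>v\<in>archimedean_places. local_height \<gamma> v)"
  unfolding height_def
proof (rule prod.mono_neutral_left[OF finite_archimedean_places])
  show "{v \<in> places. local_height \<gamma> v \<noteq> 1} \<subseteq> archimedean_places"
    using local_height_integers_nonarchimedean[OF assms] by blast
qed (auto simp: archimedean_places_def)

lemma local_height_ge_1: "1 \<le> local_height \<gamma> v"
  unfolding local_height_def by (rule Max_ge) auto

lemma height_integers_ge_1: "set (\<gamma> :: 'k list) \<subseteq> ring_of_integers \<Longrightarrow> 1 \<le> height \<gamma>"
  by (simp add: height_integers prod_ge_1 local_height_ge_1)

text \<open>
  The triangle inequality costs a factor \<open>length \<alpha> * X\<close> at every archimedean place. As this factor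
  is at least 1, the number of archimedean places may be replaced by its bound, the degree.
\<close>

lemma height_int_comb_le:
  fixes \<alpha> :: "'k list"
  assumes int: "set \<alpha> \<subseteq> ring_of_integers" "int_comb \<alpha> x \<in> ring_of_integers"
    and X: "\<And>i. i < length \<alpha> \<Longrightarrow> \<bar>x ! i\<bar> \<le> X" and nX: "1 \<le> real (length \<alpha>) * of_int X"
  shows "height [int_comb \<alpha> x] \<le> (real (length \<alpha>) * of_int X) ^ d * height \<alpha>"
proof -
  let ?m = "real (length \<alpha>) * of_int X"
  have local: "local_height [int_comb \<alpha> x] v \<le> ?m * local_height \<alpha> v" if v: "v \<in> archimedean_places" for v
  proof -
    have abs: "absolute_value v" and rat: "v (of_rat q) = \<bar>of_rat q\<bar>" for q
      using v by (auto simp: archimedean_places_def places_def)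
    have vint: "v (of_int k) = \<bar>of_int k\<bar>" for k using rat[of "of_int k"] by simp
    have "v (int_comb \<alpha> x) \<le> (\<Sum>i<length \<alpha>. v (\<alpha> ! i * of_int (x ! i)))"
      unfolding int_comb_def by (rule absolute_value_sum[OF abs])
    also have "\<dots> \<le> (\<Sum>i<length \<alpha>. local_height \<alpha> v * of_int X)"
    proof (rule sum_mono)
      fix i assume i: "i \<in> {..<length \<alpha>}"
      have "v (\<alpha> ! i) \<le> local_height \<alpha> v"
        unfolding local_height_archimedean[OF v] using i by (intro Max_ge) auto
      moreover have "v (of_int (x ! i)) \<le> of_int X"
        unfolding vint of_int_abs[symmetric] of_int_le_iff using X i by simp
      ultimately show "v (\<alpha> ! i * of_int (x ! i)) \<le> local_height \<alpha> v * of_int X"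
        unfolding absolute_valueD(3)[OF abs] using local_height_ge_1[of \<alpha> v] absolute_valueD(1)[OF abs]
        by (intro mult_mono) auto
    qed
    also have "\<dots> = ?m * local_height \<alpha> v" by simp
    finally have "v (int_comb \<alpha> x) \<le> ?m * local_height \<alpha> v" .
    moreover have "1 * 1 \<le> ?m * local_height \<alpha> v"
      using nX local_height_ge_1[of \<alpha> v] by (intro mult_mono) auto
    ultimately show ?thesis by (simp add: local_height_archimedean[OF v, of "[int_comb \<alpha> x]"])
  qed
  have "height [int_comb \<alpha> x] \<le> (\<Prod>v\<in>archimedean_places. ?m * local_height \<alpha> v)"
    using local order_trans[OF zero_le_one local_height_ge_1] int
    by (subst height_integers) (auto intro!: prod_mono)
  also have "\<dots> = ?m ^ card archimedean_places * height \<alpha>"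
    by (simp add: prod.distrib height_integers[OF int(1)])
  also have "\<dots> \<le> ?m ^ d * height \<alpha>"
    using nX height_integers_ge_1[OF int(1)] card_archimedean_places
    by (intro mult_right_mono power_increasing) auto
  finally show ?thesis .
qed

end

theorem theorem1p2:
  fixes \<alpha> :: "'k::number_field list" and \<beta> :: 'k
    and \<sigma> :: "('k \<Rightarrow> real) list" and d n :: nat
  assumes "totally_real TYPE('k)"
    and "d = field_degree TYPE('k)"
    and "length \<sigma> = d" and "distinct \<sigma>" and "set \<sigma> = {\<tau>. field_hom \<tau>}"
    and "d < n"
    and "length \<alpha> = n"
    and "\<forall>i<n. \<alpha> ! i \<noteq> 0 \<and> \<alpha> ! i \<in> nonneg_integers"
    and "ring_of_integers = int_span \<alpha>"
    and "\<beta> \<in> Sg \<alpha>"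
  shows "(\<exists>x \<in> nonneg_tuples n. int_comb \<alpha> x = \<beta>) \<and>
    (\<forall>x \<in> nonneg_tuples n. int_comb \<alpha> x = \<beta> \<longrightarrow>
       (\<beta> \<noteq> 0 \<longrightarrow>
          1 / real n * (height [\<beta>] / height \<alpha>) powr (1 / real d) \<le> real_of_int (sup_norm x)) \<and>
       real_of_int (sup_norm x) \<le> max_minor \<sigma> \<alpha> \<beta>)"
proof (intro conjI ballI impI)
  interpret E: full_embeddings \<sigma> by (rule full_embeddings.intro) (use assms(2-5) in auto)
  have int: "set \<alpha> \<subseteq> ring_of_integers"
    using assms(7,8) by (auto simp: in_set_conv_nth nonneg_integers_def)
  have d: "0 < d" using field_degree_pos[where 'k = 'k] assms(2) by simp
  show "\<exists>x\<in>nonneg_tuples n. int_comb \<alpha> x = \<beta>"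
    using assms(7,10) by (auto simp: Sg_def)
  fix x assume x: "x \<in> nonneg_tuples n" and \<beta>: "int_comb \<alpha> x = \<beta>"
  have lenx: "length x = n" and x0: "\<And>i. i < n \<Longrightarrow> 0 \<le> x ! i"
    using x by (auto simp: nonneg_tuples_def)
  have le_sup: "\<bar>x ! i\<bar> \<le> sup_norm x" if "i < n" for i
    unfolding sup_norm_def using that lenx by (intro Max_ge) auto
  show "real_of_int (sup_norm x) \<le> max_minor \<sigma> \<alpha> \<beta>"
  proof -
    have "x \<noteq> []" using lenx assms(6) by auto
    hence "sup_norm x \<in> abs ` set x" unfolding sup_norm_def by (intro Max_in) auto
    then obtain i where i: "i < n" "sup_norm x = \<bar>x ! i\<bar>" using lenx by (auto simp: in_set_conv_nth)
    have pos: "0 < \<tau> a" if "a \<in> set \<alpha>" "\<tau> \<in> set \<sigma>" for a \<tau>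
    proof -
      interpret \<tau>: field_hom \<tau> by (rule E.hom[OF that(2)])
      have "0 \<le> \<tau> a" "a \<noteq> 0"
        using that(1) assms(7,8) \<tau>.field_hom_axioms by (auto simp: in_set_conv_nth nonneg_integers_def)
      thus ?thesis using \<tau>.hom_0_iff[of a] by linarith
    qed
    have "of_int (x ! i) \<le> max_minor \<sigma> \<alpha> \<beta>"
      by (rule E.coordinate_le_max_minor[OF assms(9) int]) (use x \<beta> i assms(7) pos in auto)
    thus ?thesis using i x0[OF i(1)] by simp
  qed
  show "1 / real n * (height [\<beta>] / height \<alpha>) powr (1 / real d) \<le> real_of_int (sup_norm x)"
    if "\<beta> \<noteq> 0"
  proof -
    let ?m = "real n * of_int (sup_norm x)"
    have "\<exists>i<n. x ! i \<noteq> 0"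
    proof (rule ccontr)
      assume "\<not> ?thesis"
      hence "int_comb \<alpha> x = 0" using assms(7) by (simp add: int_comb_def)
      thus False using \<open>\<beta> \<noteq> 0\<close> \<beta> by simp
    qed
    then obtain i where i: "i < n" "x ! i \<noteq> 0" by blast
    hence "1 \<le> sup_norm x" using le_sup[OF i(1)] by linarith
    hence "1 * 1 \<le> ?m" using assms(6) by (intro mult_mono) auto
    hence m: "1 \<le> ?m" by simp
    have int\<beta>: "\<beta> \<in> ring_of_integers"
      using assms(7,9) lenx \<beta> by (auto simp: int_span_def)
    have H: "1 \<le> height \<alpha>" "1 \<le> height [\<beta>]"
      using int int\<beta> by (auto intro: E.height_integers_ge_1)
    have "height [\<beta>] \<le> ?m ^ d * height \<alpha>"
      using E.height_int_comb_le[OF int, of x "sup_norm x"] int\<beta> \<beta> le_sup m assms(3,7) by simp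
    hence "height [\<beta>] / height \<alpha> \<le> ?m ^ d" using H by (simp add: divide_le_eq)
    hence "(height [\<beta>] / height \<alpha>) powr (1 / real d) \<le> (?m ^ d) powr (1 / real d)"
      using H by (intro powr_mono2) auto
    also have "\<dots> = ?m"
      using m d by (simp add: powr_realpow[symmetric] powr_powr)
    finally show ?thesis using assms(6) by (simp add: field_simps)
  qed
qed

end
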